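(* Let $W:\mathcal{X}\to\mathcal{S}(B)$ be a cq-channel, $n\ge1$, and $0<\delta\le\sqrt{n}\log|B|$. Let $u_1,\ldots,u_N\in\mathcal{X}^n$ be codewords such that $1-\frac12\|W_{u_j}-W_{u_k}\|_1\le 2^{-3\delta\sqrt{n}}$ for all $j\neq k$. Then there exists a subset $\mathcal{C}\subset[N]$ with $|\mathcal{C}|\ge N/\lceil n\log|B|\rceil$ such that $\{(u_j,E_j=\Pi^\delta_{u_j}):j\in\mathcal{C}\}$ is an $(n,|\mathcal{C}|,\lambda_1,\lambda_2)$-DI code with $\lambda_1=\eta$ and $\lambda_2=\eta+6\exp(-\delta\sqrt{n})$, where $\eta=2\exp\!\left(-\delta^2/36K(|B|)\right)$.
   Context: A cq-channel is a measurable map $W:\mathcal{X}\to\mathcal{S}(B)$, $x\mapsto W_x$, from a measure space $\mathcal{X}$ to the density operators on a finite-dimensional Hilbert space $B$ (dimension $|B|$). For $x^n=x_1\ldots x_n$, $W_{x^n}=W_{x_1}\otimes\cdots\otimes W_{x_n}$. $\log$ and $\exp$ are to base 2; $K(d)=(\log\max\{d,3\})^2$; $S(\cdot)$ is the von Neumann entropy. The entropy typical projector $\Pi^\delta_{x^n}$ is the projector onto the span of all eigenspaces of $-\log W_{x^n}$ with eigenvalues in $[S(W_{x^n})-\delta\sqrt{n},\,S(W_{x^n})+\delta\sqrt{n}]$. An $(n,N,\lambda_1,\lambda_2)$-DI code for $W$ is a collection $\{(u_j,E_j):j\in[N]\}$ with $u_j\in\mathcal{X}^n$ and operators $0\le E_j\le\mathbb{1}$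 on $B^{\otimes n}$ such that for all $j\neq k$: $\operatorname{Tr}W_{u_j}E_j\ge1-\lambda_1$ and $\operatorname{Tr}W_{u_j}E_k\le\lambda_2$. *)

theory Defs
  imports Complex_Main "Jordan_Normal_Form.Schur_Decomposition"
begin

definition mtrace :: "complex mat \<Rightarrow> complex" where
  "mtrace A = (\<Sum>i<dim_row A. A $$ (i, i))"

definition hermitian_mat :: "complex mat \<Rightarrow> bool" where
  "hermitian_mat A \<longleftrightarrow> A \<in> carrier_mat (dim_row A) (dim_row A) \<and> mat_adjoint A = A"

definition psd_mat :: "complex mat \<Rightarrow> bool" where
  "psd_mat A \<longleftrightarrow> A \<in> carrier_mat (dim_row A) (dim_row A) \<and>
     (\<forall>v \<in> carrier_vec (dim_row A).
        Im ((A *\<^sub>v v) \<bullet>c v) = 0 \<and> Re ((A *\<^sub>v v) \<bullet>c v) \<ge> 0)"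

definition density_op :: "nat \<Rightarrow> complex mat \<Rightarrow> bool" where
  "density_op d \<rho> \<longleftrightarrow> \<rho> \<in> carrier_mat d d \<and> psd_mat \<rho> \<and> mtrace \<rho> = 1"

definition unitary_mat :: "nat \<Rightarrow> complex mat \<Rightarrow> bool" where
  "unitary_mat m U \<longleftrightarrow> U \<in> carrier_mat m m \<and> mat_adjoint U * U = 1\<^sub>m m"

definition effect_op :: "nat \<Rightarrow> complex mat \<Rightarrow> bool" where
  "effect_op m E \<longleftrightarrow> E \<in> carrier_mat m m \<and> psd_mat E \<and> psd_mat (1\<^sub>m m - E)"

text \<open>Functional calculus for Hermitian matrices, via the spectral decomposition
  A = U diag(e) U^*; the result does not depend on the chosen decomposition.\<close>
definition mat_fun :: "(real \<Rightarrow> real) \<Rightarrow> complex mat \<Rightarrow> complex mat" where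
  "mat_fun f A = (THE B. \<exists>U e. unitary_mat (dim_row A) U \<and>
      A = U * mat_diag (dim_row A) (\<lambda>i. complex_of_real (e i)) * mat_adjoint U \<and>
      B = U * mat_diag (dim_row A) (\<lambda>i. complex_of_real (f (e i))) * mat_adjoint U)"

definition kron :: "complex mat \<Rightarrow> complex mat \<Rightarrow> complex mat" where
  "kron A B = mat (dim_row A * dim_row B) (dim_col A * dim_col B)
     (\<lambda>(i, j). A $$ (i div dim_row B, j div dim_col B) * B $$ (i mod dim_row B, j mod dim_col B))"

definition tensor_word :: "('x \<Rightarrow> complex mat) \<Rightarrow> 'x list \<Rightarrow> complex mat" where
  "tensor_word W xs = foldr (\<lambda>x M. kron (W x) M) xs (1\<^sub>m 1)"

definition vn_entropy :: "complex mat \<Rightarrow> real" where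
  "vn_entropy \<rho> = Re (mtrace (mat_fun (\<lambda>t. if t \<le> 0 then 0 else - t * log 2 t) \<rho>))"

definition trace_norm :: "complex mat \<Rightarrow> real" where
  "trace_norm A = Re (mtrace (mat_fun sqrt (mat_adjoint A * A)))"

text \<open>Entropy typical projector: projector onto the eigenspaces of -log W_{x^n} with
  eigenvalues in [S - delta sqrt n, S + delta sqrt n], n = length of x^n.
  (Eigenvalue 0 of W corresponds to eigenvalue +infinity of -log W, never included.)\<close>
definition typ_proj :: "('x \<Rightarrow> complex mat) \<Rightarrow> real \<Rightarrow> 'x list \<Rightarrow> complex mat" where
  "typ_proj W \<delta> xs =
     (let \<rho> = tensor_word W xs; n = length xs; S = vn_entropy \<rho> in
      mat_fun (\<lambda>t. if t > 0 \<and> S - \<delta> * sqrt n \<le> - log 2 t \<and> - log 2 t \<le> S + \<delta> * sqrt n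
                   then 1 else 0) \<rho>)"

definition K_const :: "nat \<Rightarrow> real" where
  "K_const d = (log 2 (real (max d 3)))\<^sup>2"

definition DI_code :: "nat \<Rightarrow> ('x \<Rightarrow> complex mat) \<Rightarrow> nat \<Rightarrow> 'i set \<Rightarrow> ('i \<Rightarrow> 'x list)
    \<Rightarrow> ('i \<Rightarrow> complex mat) \<Rightarrow> real \<Rightarrow> real \<Rightarrow> bool" where
  "DI_code d W n C u E l1 l2 \<longleftrightarrow>
     finite C \<and>
     (\<forall>j\<in>C. length (u j) = n \<and> effect_op (d ^ n) (E j)) \<and>
     (\<forall>j\<in>C. Re (mtrace (tensor_word W (u j) * E j)) \<ge> 1 - l1) \<and>
     (\<forall>j\<in>C. \<forall>k\<in>C. j \<noteq> k \<longrightarrow> Re (mtrace (tensor_word W (u j) * E k)) \<le> l2)"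

end

theory Submission
  imports Defs
begin

text \<open>
  Typicality: the spectrum of \<open>W\<^bsub>x^n\<^esub>\<close> is a product distribution and \<open>- log W\<^bsub>x^n\<^esub>\<close> is a sum of
  independent variables under it, whose moment generating function is controlled near \<open>0\<close> by
  \<open>K(d)\<close>; Chernoff's bound gives \<open>\<lambda>\<^sub>1 = \<eta>\<close>.

  Distinguishability: let \<open>T\<close> be Helstrom's test for \<open>\<rho> = W\<^bsub>u_j\<^esub>\<close> against \<open>\<sigma> = W\<^bsub>u_k\<^esub>\<close>; both errors
  are at most \<open>2\<^bsup>-3a\<^esup>\<close>, where \<open>a = \<delta> \<surd>n\<close>. Up to weight \<open>\<eta>\<close>, \<open>\<rho>\<close> may be cut down to its typical part,
  which is bounded by \<open>2\<^bsup>a - S(\<rho>)\<^esup>\<close>. For the typical projector \<open>Q \<le> 2\<^bsup>S(\<sigma>) + a\<^esup> \<sigma>\<close> of \<open>\<sigma>\<close>, the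
  inequality \<open>Q \<le> 2 T Q T + 2 (1 - T)\<close> then bounds the remaining overlap by
  \<open>2 * 2\<^bsup>S(\<sigma>) - S(\<rho>) - a\<^esup> + 2 * 2\<^bsup>-3a\<^esup>\<close>, which is at most \<open>6 * 2\<^bsup>-a\<^esup>\<close> if the entropies differ by at
  most \<open>1\<close>. Since entropies lie in \<open>[0, n log d]\<close>, the pigeonhole principle provides
  a fraction \<open>1 / \<lceil>n log d\<rceil>\<close> of the codewords with such entropies.
\<close>

section \<open>Functional calculus of Hermitian matrices\<close>

abbreviation rdiag :: "nat \<Rightarrow> (nat \<Rightarrow> real) \<Rightarrow> complex mat" where
  "rdiag m f \<equiv> mat_diag m (\<lambda>i. complex_of_real (f i))"

lemma dim_mat_diag [simp]: "dim_row (mat_diag m f) = m" "dim_col (mat_diag m f) = m"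
  by (auto simp: mat_diag_def)

section \<open>Adjoints, traces and inner products\<close>

lemma dim_adjoint [simp]:
  "dim_row (mat_adjoint A) = dim_col A" "dim_col (mat_adjoint A) = dim_row A"
  by (auto simp: mat_adjoint_def)

lemma adjoint_carrier [simp, intro]: "A \<in> carrier_mat n m \<Longrightarrow> mat_adjoint A \<in> carrier_mat m n"
  unfolding carrier_mat_def by simp

lemma mult_square_carrier [simp]:
  "A \<in> carrier_mat m m \<Longrightarrow> B \<in> carrier_mat m m \<Longrightarrow> A * B \<in> carrier_mat m m"
  by (rule mult_carrier_mat)

lemma index_adjoint [simp]:
  fixes A :: "complex mat"
  assumes "i < dim_col A" "j < dim_row A"
  shows "mat_adjoint A $$ (i, j) = cnj (A $$ (j, i))"
  using assms by (simp add: mat_adjoint_def mat_of_rows_def)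

lemma adjoint_adjoint [simp]: "mat_adjoint (mat_adjoint A) = (A :: complex mat)"
  by (rule eq_matI) auto

lemma index_mult_sum:
  fixes A B :: "complex mat"
  assumes "i < dim_row A" "j < dim_col B" "dim_col A = dim_row B"
  shows "(A * B) $$ (i, j) = (\<Sum>k<dim_row B. A $$ (i, k) * B $$ (k, j))"
  using assms by (simp add: scalar_prod_def atLeast0LessThan)

lemma adjoint_mult:
  fixes A B :: "complex mat"
  assumes "A \<in> carrier_mat n m" "B \<in> carrier_mat m l"
  shows "mat_adjoint (A * B) = mat_adjoint B * mat_adjoint A"
  using assms
  by (intro eq_matI) (auto simp: index_mult_sum mult.commute simp del: index_mult_mat(1))

lemma adjoint_minus:
  fixes A B :: "complex mat"
  assumes "A \<in> carrier_mat n m" "B \<in> carrier_mat n m"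
  shows "mat_adjoint (A - B) = mat_adjoint A - mat_adjoint B"
  using assms by (intro eq_matI) auto

lemma adjoint_rdiag [simp]: "mat_adjoint (rdiag m f) = rdiag m f"
  by (intro eq_matI) (auto simp: mat_diag_def)

lemma adjoint_one [simp]: "mat_adjoint (1\<^sub>m m :: complex mat) = 1\<^sub>m m"
  by (intro eq_matI) auto

lemma rdiag_one [simp]: "rdiag m (\<lambda>_. 1) = 1\<^sub>m m"
  by (auto simp: mat_diag_def intro!: eq_matI)

lemma mtrace_comm:
  assumes "A \<in> carrier_mat n m" "B \<in> carrier_mat m n"
  shows "mtrace (A * B) = mtrace (B * A)"
proof -
  have "mtrace (A * B) = (\<Sum>i<n. \<Sum>k<m. A $$ (i, k) * B $$ (k, i))"
    using assms by (simp add: mtrace_def index_mult_sum del: index_mult_mat(1))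
  also have "\<dots> = (\<Sum>k<m. \<Sum>i<n. B $$ (k, i) * A $$ (i, k))"
    by (subst sum.swap) (simp add: mult.commute)
  also have "\<dots> = mtrace (B * A)"
    using assms by (simp add: mtrace_def index_mult_sum del: index_mult_mat(1))
  finally show ?thesis .
qed

lemma mtrace_minus:
  assumes "A \<in> carrier_mat n n" "B \<in> carrier_mat n n"
  shows "mtrace (A - B) = mtrace A - mtrace B"
  using assms by (simp add: mtrace_def sum_subtractf)

lemma sprod_conj_sum: "dim_vec v = n \<Longrightarrow> dim_vec w = n \<Longrightarrow> v \<bullet>c w = (\<Sum>i<n. v $ i * cnj (w $ i))"
  for v w :: "complex vec"
  by (simp add: scalar_prod_def atLeast0LessThan)

lemma adjoint_sprod:
  fixes A :: "complex mat"
  assumes "A \<in> carrier_mat n m" "v \<in> carrier_vec m" "w \<in> carrier_vec n"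
  shows "(A *\<^sub>v v) \<bullet>c w = v \<bullet>c (mat_adjoint A *\<^sub>v w)"
proof -
  have "(A *\<^sub>v v) \<bullet>c w = (\<Sum>i<n. \<Sum>j<m. A $$ (i, j) * v $ j * cnj (w $ i))"
    using assms by (subst sprod_conj_sum[of _ n])
      (auto simp: scalar_prod_def atLeast0LessThan sum_distrib_right)
  also have "\<dots> = (\<Sum>j<m. \<Sum>i<n. A $$ (i, j) * v $ j * cnj (w $ i))"
    by (rule sum.swap)
  also have "\<dots> = v \<bullet>c (mat_adjoint A *\<^sub>v w)"
    using assms by (subst sprod_conj_sum[of _ m])
      (auto simp: scalar_prod_def atLeast0LessThan sum_distrib_left mult_ac)
  finally show ?thesis .
qed

lemma adjoint_mult_index:
  fixes A B :: "complex mat"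
  assumes "A \<in> carrier_mat n m" "B \<in> carrier_mat n l" "i < m" "j < l"
  shows "(mat_adjoint A * B) $$ (i, j) = col B j \<bullet>c col A i"
  using assms by (subst sprod_conj_sum[of _ n])
    (auto simp: index_mult_sum mult.commute simp del: index_mult_mat(1))

section \<open>Unitary matrices and spectral decompositions\<close>

lemma unitary_carrier: "unitary_mat m U \<Longrightarrow> U \<in> carrier_mat m m"
  by (simp add: unitary_mat_def)

lemma unitary_right:
  assumes "unitary_mat m U"
  shows "U * mat_adjoint U = 1\<^sub>m m"
  using assms mat_mult_left_right_inverse[of "mat_adjoint U" m U] by (auto simp: unitary_mat_def)

lemma unitary_mult:
  assumes "unitary_mat m U" "unitary_mat m V"
  shows "unitary_mat m (U * V)"
proof -
  have U: "U \<in> carrier_mat m m" "V \<in> carrier_mat m m" using assms by (auto simp: unitary_mat_def)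
  have "mat_adjoint (U * V) * (U * V) = mat_adjoint V * (mat_adjoint U * U) * V"
    using U by (simp add: adjoint_mult[of _ m m] assoc_mult_mat[of _ m m _ m _ m])
  thus ?thesis using assms U by (simp add: unitary_mat_def)
qed

text \<open>Names the eigenbasis and the eigenvalues explicitly, so that several operators can later
  be compared in one common eigenbasis \<open>U\<close>.\<close>

definition spectral :: "nat \<Rightarrow> complex mat \<Rightarrow> complex mat \<Rightarrow> (nat \<Rightarrow> real) \<Rightarrow> bool" where
  "spectral m A U e \<longleftrightarrow> unitary_mat m U \<and> A = U * rdiag m e * mat_adjoint U"

lemma spectral_carrier: "spectral m A U e \<Longrightarrow> A \<in> carrier_mat m m"
  by (auto simp: spectral_def unitary_mat_def)

lemma spectral_adjoint:
  assumes "spectral m A U e"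
  shows "mat_adjoint A = A"
proof -
  have U: "U \<in> carrier_mat m m" and A: "A = U * rdiag m e * mat_adjoint U"
    using assms by (auto simp: spectral_def unitary_mat_def)
  show ?thesis unfolding A using U
    by (simp add: adjoint_mult[of _ m m _ m] assoc_mult_mat[of _ m m _ m _ m])
qed

lemma conj_rdiag_mult:
  assumes "unitary_mat m U"
  shows "(U * rdiag m f * mat_adjoint U) * (U * rdiag m g * mat_adjoint U)
    = U * rdiag m (\<lambda>i. f i * g i) * mat_adjoint U"
proof -
  have U: "U \<in> carrier_mat m m" "mat_adjoint U * U = 1\<^sub>m m"
    using assms by (auto simp: unitary_mat_def)
  have "(U * rdiag m f * mat_adjoint U) * (U * rdiag m g * mat_adjoint U)
    = U * (rdiag m f * ((mat_adjoint U * U) * rdiag m g)) * mat_adjoint U"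
    using U(1) by (simp add: assoc_mult_mat[of _ m m _ m _ m])
  also have "rdiag m f * ((mat_adjoint U * U) * rdiag m g) = rdiag m (\<lambda>i. f i * g i)"
    by (simp add: U(2) left_mult_one_mat[of _ m m])
  finally show ?thesis .
qed

lemma spectral_mult:
  "spectral m A U f \<Longrightarrow> spectral m B U g \<Longrightarrow> spectral m (A * B) U (\<lambda>i. f i * g i)"
  by (simp add: spectral_def conj_rdiag_mult)

text \<open>Two diagonalisations of \<open>A\<close> are linked by \<open>G\<close>, which
  intertwines \<open>e\<close> and \<open>g\<close>. An entry of \<open>G\<close> can be nonzero
  only where the two eigenvalues agree, so \<open>G\<close> also intertwines their images under
  \<open>f\<close>. This justifies the definite description in \<open>mat_fun\<close>.\<close>

lemma mat_fun_spectral: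
  assumes "spectral m A U e"
  shows "mat_fun f A = U * rdiag m (\<lambda>i. f (e i)) * mat_adjoint U"
  unfolding mat_fun_def
proof (rule the_equality)
  have [simp]: "dim_row A = m" using spectral_carrier[OF assms] by auto
  show "\<exists>U' e'. unitary_mat (dim_row A) U' \<and> A = U' * rdiag (dim_row A) e' * mat_adjoint U' \<and>
      U * rdiag m (\<lambda>i. f (e i)) * mat_adjoint U
        = U' * rdiag (dim_row A) (\<lambda>i. f (e' i)) * mat_adjoint U'"
    using assms unfolding \<open>dim_row A = m\<close> spectral_def by blast
  fix B
  assume "\<exists>U' e'. unitary_mat (dim_row A) U' \<and> A = U' * rdiag (dim_row A) e' * mat_adjoint U' \<and>
      B = U' * rdiag (dim_row A) (\<lambda>i. f (e' i)) * mat_adjoint U'"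
  then obtain V g where V: "unitary_mat m V" "A = V * rdiag m g * mat_adjoint V"
    and B: "B = V * rdiag m (\<lambda>i. f (g i)) * mat_adjoint V"
    by auto
  have U: "unitary_mat m U" "A = U * rdiag m e * mat_adjoint U"
    using assms by (auto simp: spectral_def)
  note c = unitary_carrier[OF U(1)] unitary_carrier[OF V(1)]
  have UU: "mat_adjoint U * U = 1\<^sub>m m" "mat_adjoint V * V = 1\<^sub>m m"
    using U V by (auto simp: unitary_mat_def)
  define G where "G = mat_adjoint V * U"
  have G: "G \<in> carrier_mat m m" using c by (auto simp: G_def)
  have "G * rdiag m e = mat_adjoint V * (U * rdiag m e * mat_adjoint U) * U"
    using c by (simp add: G_def assoc_mult_mat[of _ m m _ m _ m] UU right_mult_one_mat[of _ m m])
  also have "\<dots> = mat_adjoint V * (V * rdiag m g * mat_adjoint V) * U"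
    using U V by simp
  also have "\<dots> = (mat_adjoint V * V) * rdiag m g * (mat_adjoint V * U)"
    using c by (simp add: assoc_mult_mat[of _ m m _ m _ m])
  also have "\<dots> = rdiag m g * G"
    by (simp add: UU G_def left_mult_one_mat[of _ m m])
  finally have comm: "G * rdiag m e = rdiag m g * G" .
  have "G $$ (i, j) * f (e j) = f (g i) * G $$ (i, j)" if "i < m" "j < m" for i j
  proof -
    have "G $$ (i, j) * e j = g i * G $$ (i, j)"
      using arg_cong[OF comm, of "\<lambda>M. M $$ (i, j)"] G that
      by (simp add: mat_diag_mult_left[of _ m m] mat_diag_mult_right[of _ m m])
    hence "G $$ (i, j) = 0 \<or> e j = g i"
      by (auto simp: mult.commute)
    thus ?thesis by auto
  qed
  hence comm': "G * rdiag m (\<lambda>i. f (e i)) = rdiag m (\<lambda>i. f (g i)) * G"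
    using G by (auto simp: mat_diag_mult_left[of _ m m] mat_diag_mult_right[of _ m m] intro!: eq_matI)
  have "U * rdiag m (\<lambda>i. f (e i)) * mat_adjoint U
      = (V * mat_adjoint V) * U * rdiag m (\<lambda>i. f (e i)) * mat_adjoint U"
    using c unitary_right[OF V(1)] by (simp add: left_mult_one_mat[of _ m m])
  also have "\<dots> = V * (G * rdiag m (\<lambda>i. f (e i))) * mat_adjoint U"
    using c by (simp add: G_def assoc_mult_mat[of _ m m _ m _ m])
  also have "\<dots> = V * rdiag m (\<lambda>i. f (g i)) * mat_adjoint V * (U * mat_adjoint U)"
    unfolding comm' using c by (simp add: G_def assoc_mult_mat[of _ m m _ m _ m])
  also have "\<dots> = B"
    using c unitary_right[OF U(1)] by (simp add: B right_mult_one_mat[of _ m m])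
  finally show "B = U * rdiag m (\<lambda>i. f (e i)) * mat_adjoint U" by simp
qed

lemma spectral_mat_fun: "spectral m A U e \<Longrightarrow> spectral m (mat_fun f A) U (\<lambda>i. f (e i))"
  using mat_fun_spectral[of m A U e f] by (simp add: spectral_def)

text \<open>Cyclicity of the trace leaves the diagonal of \<open>M\<close> in the eigenbasis of
  \<open>A\<close>. Overlaps of states with projections are evaluated in this way.\<close>

lemma mtrace_spectral_mult:
  assumes "spectral m A U e" "M \<in> carrier_mat m m"
  shows "mtrace (A * M) = (\<Sum>i<m. e i * ((M *\<^sub>v col U i) \<bullet>c col U i))"
proof -
  have U: "U \<in> carrier_mat m m" and A: "A = U * rdiag m e * mat_adjoint U"
    using assms by (auto simp: spectral_def unitary_mat_def)
  have "mtrace (A * M) = mtrace (U * (rdiag m e * mat_adjoint U * M))"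
    using U assms(2) by (simp add: A assoc_mult_mat[of _ m m _ m _ m])
  also have "\<dots> = mtrace (rdiag m e * mat_adjoint U * M * U)"
    using U assms(2) by (intro mtrace_comm) auto
  also have "rdiag m e * mat_adjoint U * M * U = rdiag m e * (mat_adjoint U * (M * U))"
    using U assms(2) by (simp add: assoc_mult_mat[of _ m m _ m _ m])
  also have "mtrace \<dots> = (\<Sum>i<m. e i * (mat_adjoint U * (M * U)) $$ (i, i))"
    using U assms(2)
    by (subst mat_diag_mult_left[of _ m m]) (auto simp: mtrace_def)
  also have "\<dots> = (\<Sum>i<m. e i * ((M *\<^sub>v col U i) \<bullet>c col U i))"
  proof (rule sum.cong)
    fix i assume i: "i \<in> {..<m}"
    have "col (M * U) i = M *\<^sub>v col U i" using U assms(2) i by (intro col_mult2[of M m m U m i]) auto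
    thus "e i * (mat_adjoint U * (M * U)) $$ (i, i) = e i * ((M *\<^sub>v col U i) \<bullet>c col U i)"
      using U assms(2) i by (subst adjoint_mult_index[of _ m m _ m]) auto
  qed simp
  finally show ?thesis .
qed

lemma unitary_col_norm:
  assumes "unitary_mat m U" "i < m"
  shows "col U i \<bullet>c col U i = 1"
  using adjoint_mult_index[of U m m U m i i] assms
  by (simp add: unitary_mat_def del: index_mult_mat(1))

lemma mtrace_spectral:
  assumes "spectral m A U e"
  shows "mtrace A = (\<Sum>i<m. complex_of_real (e i))"
proof -
  have U: "unitary_mat m U" using assms by (simp add: spectral_def)
  have "A = A * 1\<^sub>m m" using spectral_carrier[OF assms] by simp
  hence "mtrace A = (\<Sum>i<m. e i * ((1\<^sub>m m *\<^sub>v col U i) \<bullet>c col U i))"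
    using mtrace_spectral_mult[OF assms, of "1\<^sub>m m"] by simp
  also have "\<dots> = (\<Sum>i<m. e i)"
    using unitary_carrier[OF U] unitary_col_norm[OF U] by (auto intro!: sum.cong)
  finally show ?thesis by simp
qed

lemma spectral_form:
  assumes "spectral m A U e" "v \<in> carrier_vec m"
  shows "(A *\<^sub>v v) \<bullet>c v = (\<Sum>i<m. complex_of_real (e i * (cmod ((mat_adjoint U *\<^sub>v v) $ i))\<^sup>2))"
proof -
  have U: "U \<in> carrier_mat m m" and A: "A = U * rdiag m e * mat_adjoint U"
    using assms by (auto simp: spectral_def unitary_mat_def)
  define w where "w = mat_adjoint U *\<^sub>v v"
  have w: "w \<in> carrier_vec m"
    unfolding w_def using mult_mat_vec_carrier[OF adjoint_carrier[OF U] assms(2)] .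
  have "A *\<^sub>v v = U *\<^sub>v (rdiag m e *\<^sub>v w)"
    using U assms(2) by (simp add: A w_def assoc_mult_mat_vec[of _ m m _ m] assoc_mult_mat[of _ m m _ m _ m])
  hence "(A *\<^sub>v v) \<bullet>c v = (rdiag m e *\<^sub>v w) \<bullet>c w"
    using adjoint_sprod[OF U mult_mat_vec_carrier[OF mat_diag_dim w] assms(2)]
    by (simp add: w_def)
  also have "\<dots> = (\<Sum>i<m. (rdiag m e *\<^sub>v w) $ i * cnj (w $ i))"
    using w by (intro sprod_conj_sum) auto
  also have "\<dots> = (\<Sum>i<m. complex_of_real (e i) * (w $ i * cnj (w $ i)))"
    using w by (intro sum.cong)
      (auto simp: mat_diag_def scalar_prod_def if_distrib[of "\<lambda>c. c * _"] sum.delta' cong: if_cong)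
  finally show ?thesis
    by (simp add: complex_norm_square w_def del: of_real_power)
qed

lemma spectral_psd:
  assumes "spectral m A U e" "\<And>i. i < m \<Longrightarrow> e i \<ge> 0"
  shows "psd_mat A"
proof -
  have "A \<in> carrier_mat m m" by (rule spectral_carrier[OF assms(1)])
  thus ?thesis
    using assms(2) by (auto simp: psd_mat_def spectral_form[OF assms(1)] intro!: sum_nonneg)
qed

text \<open>Testing the quadratic form on the eigenvector \<open>col U i\<close> isolates
  \<open>e i\<close>.\<close>

lemma psd_spectral_nonneg:
  assumes "spectral m A U e" "psd_mat A" "i < m"
  shows "e i \<ge> 0"
proof -
  have U: "unitary_mat m U" using assms by (simp add: spectral_def)
  note c = unitary_carrier[OF U]
  have v: "col U i \<in> carrier_vec m" using c by auto
  have "mat_adjoint U *\<^sub>v col U i = col (1\<^sub>m m) i"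
    using U c assms(3) col_mult2[of "mat_adjoint U" m m U m i] by (simp add: unitary_mat_def)
  hence "(A *\<^sub>v col U i) \<bullet>c col U i
      = (\<Sum>j<m. complex_of_real (e j * (cmod (if j = i then 1 else 0))\<^sup>2))"
    using assms(3) unfolding spectral_form[OF assms(1) v] by (intro sum.cong) auto
  also have "\<dots> = (\<Sum>j<m. if j = i then complex_of_real (e j) else 0)"
    by (intro sum.cong) auto
  also have "\<dots> = e i" using assms(3) by simp
  finally show ?thesis
    using assms(2) v spectral_carrier[OF assms(1)] by (auto simp: psd_mat_def)
qed

section \<open>The spectral theorem\<close>

lemma csquare_norm_vec:
  fixes w :: "complex vec"
  shows "w \<bullet>c w = complex_of_real (\<Sum>i<dim_vec w. (cmod (w $ i))\<^sup>2)"
  by (simp add: sprod_conj_sum[of w "dim_vec w"] complex_norm_square del: of_real_power)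

text \<open>Completing \<open>v\<close> to a basis and orthogonalising keeps \<open>v\<close> as the
  first vector; normalising the columns then gives \<open>W\<close>, and \<open>c\<close> is the
  factor by which \<open>v\<close> is scaled.\<close>

lemma unitary_first_column:
  fixes v :: "complex vec"
  assumes v: "v \<in> carrier_vec n" and v0: "v \<noteq> 0\<^sub>v n" and n: "0 < n"
  shows "\<exists>W c. unitary_mat n W \<and> col W 0 = c \<cdot>\<^sub>v v"
proof -
  interpret cof_vec_space n "TYPE(complex)" .
  define b where "b = basis_completion v"
  define ws where "ws = gram_schmidt n b"
  from basis_completion[OF v v0, folded b_def]
  have dist_b: "distinct b" and indep: "\<not> lin_dep (set b)" and b: "set b \<subseteq> carrier_vec n"
    and hdb: "hd b = v" and len_b: "length b = n" by auto
  from hdb len_b n obtain vs where bv: "b = v # vs" by (cases b, auto)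
  from gram_schmidt_result[OF b dist_b indep refl, folded ws_def]
  have ws: "set ws \<subseteq> carrier_vec n" "corthogonal ws" "length ws = n"
    by (auto simp: len_b)
  have hdws: "ws ! 0 = v"
    using gram_schmidt_hd[OF v, of vs, folded bv] ws n by (cases ws) (auto simp: ws_def)
  \<comment> \<open>The vectors \<open>ws\<close> are orthogonal but not normalised;
    \<open>a i\<close> is the inverse of the norm of \<open>ws ! i\<close>.\<close>
  define a where "a = (\<lambda>i. 1 / sqrt (Re (ws ! i \<bullet>c ws ! i)))"
  define W where "W = mat_of_cols n (map (\<lambda>i. complex_of_real (a i) \<cdot>\<^sub>v ws ! i) [0..<n])"
  have W: "W \<in> carrier_mat n n" by (auto simp: W_def)
  have wsc: "ws ! i \<in> carrier_vec n" if "i < n" for i using that ws by auto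
  have colW: "col W i = complex_of_real (a i) \<cdot>\<^sub>v ws ! i" if "i < n" for i
    using that wsc[OF that] by (simp add: W_def)
  have "mat_adjoint W * W = 1\<^sub>m n"
  proof (rule eq_matI)
    fix i j assume "i < dim_row (1\<^sub>m n :: complex mat)" "j < dim_col (1\<^sub>m n :: complex mat)"
    hence ij: "i < n" "j < n" by auto
    have "(mat_adjoint W * W) $$ (i, j) = a j * a i * (ws ! j \<bullet>c ws ! i)"
      using ij W carrier_vecD[OF wsc[OF ij(1)]] carrier_vecD[OF wsc[OF ij(2)]]
      by (subst adjoint_mult_index[of _ n n _ n])
        (auto simp: colW sprod_conj_sum[of _ n] sum_distrib_left mult_ac)
    also have "\<dots> = (if i = j then 1 else 0)"
    proof (cases "i = j")
      case True
      define s where "s = (\<Sum>k<dim_vec (ws ! i). (cmod (ws ! i $ k))\<^sup>2)"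
      have s: "ws ! i \<bullet>c ws ! i = complex_of_real s"
        by (simp add: csquare_norm_vec s_def)
      have "s \<noteq> 0" using corthogonalD[OF ws(2), of i i] ij ws s by auto
      moreover have "s \<ge> 0" by (auto simp: s_def intro!: sum_nonneg)
      ultimately have "a i * a i * s = 1" by (simp add: a_def s)
      thus ?thesis using True s by (metis of_real_1 of_real_mult)
    next
      case False
      thus ?thesis using corthogonalD[OF ws(2), of j i] ij ws by auto
    qed
    finally show "(mat_adjoint W * W) $$ (i, j) = 1\<^sub>m n $$ (i, j)" using ij by simp
  qed (use W in auto)
  thus ?thesis using W colW[OF n] hdws by (auto simp: unitary_mat_def)
qed

text \<open>The block form reached once an eigenvector is split off. It respects products and
  adjoints, so a diagonalisation of the smaller block lifts to the whole matrix.\<close>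

definition direct_sum1 :: "nat \<Rightarrow> complex \<Rightarrow> complex mat \<Rightarrow> complex mat" where
  "direct_sum1 n c M = mat (Suc n) (Suc n) (\<lambda>(i, j).
     case i of 0 \<Rightarrow> (case j of 0 \<Rightarrow> c | Suc _ \<Rightarrow> 0)
     | Suc i' \<Rightarrow> (case j of 0 \<Rightarrow> 0 | Suc j' \<Rightarrow> M $$ (i', j')))"

lemma direct_sum1_carrier [simp]: "direct_sum1 n c M \<in> carrier_mat (Suc n) (Suc n)"
  by (simp add: direct_sum1_def)

lemma direct_sum1_mult:
  assumes "M \<in> carrier_mat n n" "M' \<in> carrier_mat n n"
  shows "direct_sum1 n c M * direct_sum1 n c' M' = direct_sum1 n (c * c') (M * M')"
  using assms
  by (intro eq_matI)
    (auto simp: direct_sum1_def index_mult_sum sum.lessThan_Suc_shift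
      simp del: index_mult_mat(1) sum.lessThan_Suc split: nat.splits)

lemma direct_sum1_adjoint:
  assumes "M \<in> carrier_mat n n"
  shows "mat_adjoint (direct_sum1 n c M) = direct_sum1 n (cnj c) (mat_adjoint M)"
  using assms by (intro eq_matI) (auto simp: direct_sum1_def split: nat.splits)

lemma direct_sum1_one: "direct_sum1 n 1 (1\<^sub>m n) = 1\<^sub>m (Suc n)"
  by (intro eq_matI) (auto simp: direct_sum1_def split: nat.splits)

lemma direct_sum1_rdiag:
  "direct_sum1 n (complex_of_real c) (rdiag n f) = rdiag (Suc n) (case_nat c f)"
  by (intro eq_matI) (auto simp: direct_sum1_def mat_diag_def split: nat.splits)

text \<open>Induction on the dimension. The characteristic polynomial splits over the complex
  numbers, so an eigenvector exists; a unitary with this direction as first column turns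
  \<open>A\<close> into an eigenvalue and a smaller Hermitian block.\<close>

theorem spectral_theorem:
  assumes "A \<in> carrier_mat n n" "mat_adjoint A = A"
  shows "\<exists>U e. spectral n A U e"
  using assms
proof (induction n arbitrary: A)
  case 0
  have "spectral 0 A (1\<^sub>m 0) (\<lambda>_. 0)"
    using 0 by (auto simp: spectral_def unitary_mat_def intro!: eq_matI)
  thus ?case by blast
next
  case (Suc n)
  note A = Suc.prems(1)
  from char_poly_factorized[OF A] obtain as where
    as: "char_poly A = (\<Prod>a\<leftarrow>as. [:- a, 1:])" "length as = Suc n" by auto
  then obtain a as' where "as = a # as'" by (cases as) auto
  hence "poly (char_poly A) a = 0" by (simp add: as)
  hence "eigenvalue A a" by (simp add: eigenvalue_root_char_poly[OF A])
  then obtain v where v: "v \<in> carrier_vec (Suc n)" "v \<noteq> 0\<^sub>v (Suc n)" "A *\<^sub>v v = a \<cdot>\<^sub>v v"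
    using A by (auto simp: eigenvalue_def eigenvector_def)
  from unitary_first_column[OF v(1,2)] obtain W c
    where W: "unitary_mat (Suc n) W" and W0: "col W 0 = c \<cdot>\<^sub>v v" by auto
  note cW = unitary_carrier[OF W]
  have WW: "mat_adjoint W * W = 1\<^sub>m (Suc n)" using W by (simp add: unitary_mat_def)
  define A' where "A' = mat_adjoint W * A * W"
  have A': "A' \<in> carrier_mat (Suc n) (Suc n)" using cW A by (auto simp: A'_def)
  have herm: "mat_adjoint A' = A'"
    using cW A Suc.prems(2)
    by (simp add: A'_def adjoint_mult[of _ "Suc n" "Suc n" _ "Suc n"]
        assoc_mult_mat[of _ "Suc n" "Suc n" _ "Suc n" _ "Suc n"])
  have col0: "A' $$ (i, 0) = (if i = 0 then a else 0)" if "i < Suc n" for i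
  proof -
    have "A *\<^sub>v col W 0 = a \<cdot>\<^sub>v col W 0"
      using A v unfolding W0 by (simp add: mult_mat_vec[of A "Suc n" "Suc n"] smult_smult_assoc mult.commute)
    hence "col (A * W) 0 = a \<cdot>\<^sub>v col W 0"
      using col_mult2[OF A cW, of 0] by (simp del: col_mult)
    hence "A' $$ (i, 0) = (a \<cdot>\<^sub>v col W 0) \<bullet>c col W i"
      using cW A that adjoint_mult_index[of W "Suc n" "Suc n" "A * W" "Suc n" i 0]
      by (simp add: A'_def assoc_mult_mat[of _ "Suc n" "Suc n" _ "Suc n" _ "Suc n"])
    also have "\<dots> = a * (mat_adjoint W * W) $$ (i, 0)"
      using cW that by (subst adjoint_mult_index[of W "Suc n" "Suc n" W "Suc n"]) auto
    finally show ?thesis using that by (simp add: WW)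
  qed
  have sym: "A' $$ (i, j) = cnj (A' $$ (j, i))" if "i < Suc n" "j < Suc n" for i j
    using that A' index_adjoint[of i A' j] by (simp add: herm)
  \<comment> \<open>The eigenvalue is a diagonal entry of the Hermitian matrix \<open>A'\<close>,
    hence real.\<close>
  have a: "a = complex_of_real (Re a)"
    using sym[of 0 0] col0[of 0] by (simp add: complex_eq_iff)
  define M where "M = mat n n (\<lambda>(i, j). A' $$ (Suc i, Suc j))"
  have M: "M \<in> carrier_mat n n" by (simp add: M_def)
  have "mat_adjoint M = M"
    using A' by (intro eq_matI) (auto simp: M_def intro!: sym[symmetric])
  from Suc.IH[OF M this] obtain U e where "spectral n M U e" by blast
  hence U: "unitary_mat n U" and MU: "M = U * rdiag n e * mat_adjoint U"
    by (auto simp: spectral_def)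
  note cU = unitary_carrier[OF U]
  \<comment> \<open>The first column vanishes below the diagonal because of the eigenvector, the
    first row then by Hermitian symmetry.\<close>
  have A'M: "A' = direct_sum1 n (Re a) M"
  proof (rule eq_matI)
    fix i j assume "i < dim_row (direct_sum1 n (Re a) M)" "j < dim_col (direct_sum1 n (Re a) M)"
    hence ij: "i < Suc n" "j < Suc n" by (auto simp: direct_sum1_def)
    show "A' $$ (i, j) = direct_sum1 n (Re a) M $$ (i, j)"
      using ij col0[OF ij(1)] col0[OF ij(2)] sym[OF ij] a
      by (auto simp: direct_sum1_def M_def split: nat.splits)
  qed (use A' in \<open>auto simp: direct_sum1_def\<close>)
  define V where "V = direct_sum1 n 1 U"
  have V: "unitary_mat (Suc n) V"
    using U cU by (simp add: unitary_mat_def V_def direct_sum1_adjoint direct_sum1_mult direct_sum1_one)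
  note cV = unitary_carrier[OF V]
  have A'V: "A' = V * rdiag (Suc n) (case_nat (Re a) e) * mat_adjoint V"
    using cU
    by (simp add: A'M MU V_def direct_sum1_adjoint direct_sum1_rdiag[symmetric] direct_sum1_mult)
  have "A = (W * mat_adjoint W) * A * (W * mat_adjoint W)"
    using A by (simp add: unitary_right[OF W])
  also have "\<dots> = W * A' * mat_adjoint W"
    using cW A by (simp add: A'_def assoc_mult_mat[of _ "Suc n" "Suc n" _ "Suc n" _ "Suc n"])
  also have "\<dots> = (W * V) * rdiag (Suc n) (case_nat (Re a) e) * mat_adjoint (W * V)"
    using cW cV
    by (simp add: A'V adjoint_mult[of _ "Suc n" "Suc n"] assoc_mult_mat[of _ "Suc n" "Suc n" _ "Suc n" _ "Suc n"])
  finally have "spectral (Suc n) A (W * V) (case_nat (Re a) e)"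
    using unitary_mult[OF W V] by (simp add: spectral_def)
  thus ?case by blast
qed

section \<open>Positive matrices and density operators\<close>

lemma form_two_coordinates:
  fixes A :: "complex mat" and c :: complex
  assumes "A \<in> carrier_mat n n" "i < n" "j < n"
  defines "v \<equiv> unit_vec n i + c \<cdot>\<^sub>v unit_vec n j"
  shows "(A *\<^sub>v v) \<bullet>c v = A $$ (i, i) + c * A $$ (i, j) + cnj c * A $$ (j, i) + c * cnj c * A $$ (j, j)"
proof -
  have v: "v \<in> carrier_vec n" by (simp add: v_def)
  have Av: "(A *\<^sub>v v) $ k = A $$ (k, i) + c * A $$ (k, j)" if "k < n" for k
    using assms(1-3) that
    by (simp add: v_def scalar_prod_def unit_vec_def algebra_simps sum.distrib sum_distrib_left[symmetric]
        if_distrib[of "\<lambda>x. _ * x"] sum.delta cong: if_cong)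
  have "(A *\<^sub>v v) \<bullet>c v = (\<Sum>k<n. (A *\<^sub>v v) $ k * cnj (v $ k))"
    using assms(1) v by (intro sprod_conj_sum) auto
  also have "\<dots> = (\<Sum>k<n. (if k = i then (A *\<^sub>v v) $ k else 0) + (if k = j then cnj c * (A *\<^sub>v v) $ k else 0))"
    by (intro sum.cong) (auto simp: v_def unit_vec_def algebra_simps)
  also have "\<dots> = (A *\<^sub>v v) $ i + cnj c * (A *\<^sub>v v) $ j"
    using assms(2,3) by (simp add: sum.distrib)
  finally show ?thesis using assms(2,3) by (simp add: Av algebra_simps)
qed

text \<open>\<open>psd_mat\<close> speaks only of the quadratic form; over the complex numbers
  polarisation recovers Hermitian symmetry from the form being real.\<close>

lemma psd_adjoint:
  assumes "psd_mat A" "A \<in> carrier_mat n n"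
  shows "mat_adjoint A = A"
proof (rule eq_matI)
  fix i j assume "i < dim_row A" "j < dim_col A"
  hence ij: "i < n" "j < n" using assms(2) by auto
  have real: "Im (A $$ (i, i) + c * A $$ (i, j) + cnj c * A $$ (j, i) + c * cnj c * A $$ (j, j)) = 0"
    if "i < n" "j < n" for c i j
  proof -
    have "unit_vec n i + c \<cdot>\<^sub>v unit_vec n j \<in> carrier_vec (dim_row A)"
      using assms(2) by simp
    thus ?thesis
      unfolding form_two_coordinates[OF assms(2) that, of c, symmetric]
      using assms(1) by (simp only: psd_mat_def)
  qed
  have "Im (A $$ (i, i)) = 0" "Im (A $$ (j, j)) = 0"
    using real[of i i 0] real[of j j 0] ij by auto
  \<comment> \<open>Coefficient \<open>1\<close> makes the imaginary parts of the entries at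
    \<open>(i, j)\<close> and \<open>(j, i)\<close> opposite, coefficient \<open>\<i>\<close> makes
    their real parts equal.\<close>
  thus "mat_adjoint A $$ (i, j) = A $$ (i, j)"
    using real[OF ij, of 1] real[OF ij, of \<i>] assms(2) ij by (auto simp: complex_eq_iff)
qed (use assms in auto)

lemma density_spectral:
  assumes "density_op d \<rho>"
  shows "\<exists>U e. spectral d \<rho> U e \<and> (\<forall>i<d. e i \<ge> 0) \<and> (\<Sum>i<d. e i) = 1"
proof -
  from assms have r: "\<rho> \<in> carrier_mat d d" "psd_mat \<rho>" "mtrace \<rho> = 1" by (auto simp: density_op_def)
  from spectral_theorem[OF r(1) psd_adjoint[OF r(2,1)]] obtain U e where s: "spectral d \<rho> U e" by blast
  have "complex_of_real (\<Sum>i<d. e i) = 1" using mtrace_spectral[OF s] r(3) by simp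
  hence "(\<Sum>i<d. e i) = 1" using of_real_eq_1_iff by blast
  thus ?thesis using s psd_spectral_nonneg[OF s r(2)] by blast
qed

section \<open>Tensor products\<close>

text \<open>Quotient and remainder by \<open>b\<close> identify the numbers below
  \<open>a * b\<close> with pairs. This is the index convention of \<open>kron\<close>, so sums over
  a tensor product become double sums.\<close>

lemma sum_div_mod:
  fixes g :: "nat \<Rightarrow> nat \<Rightarrow> 'a :: comm_monoid_add"
  shows "(\<Sum>k<a * b. g (k div b) (k mod b)) = (\<Sum>i<a. \<Sum>j<b. g i j)"
proof (cases "b = 0")
  case False
  have "(\<Sum>i<a. \<Sum>j<b. g i j) = (\<Sum>(i, j)\<in>{..<a} \<times> {..<b}. g i j)"
    by (rule sum.cartesian_product)
  also have "\<dots> = (\<Sum>k<a * b. g (k div b) (k mod b))"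
  proof (rule sum.reindex_bij_witness[where i = "\<lambda>k. (k div b, k mod b)" and j = "\<lambda>(i, j). i * b + j"])
    fix p assume "p \<in> {..<a} \<times> {..<b}"
    then obtain i j where p: "p = (i, j)" "i < a" "j < b" by auto
    have "i * b + j < Suc i * b" using p by simp
    also have "\<dots> \<le> a * b" using p by (intro mult_le_mono1) auto
    finally show "(case p of (i, j) \<Rightarrow> i * b + j) \<in> {..<a * b}" using p by simp
  qed (use False in \<open>auto simp: less_mult_imp_div_less\<close>)
  finally show ?thesis by simp
qed simp

lemma sum_div_mod_prod:
  fixes f g :: "nat \<Rightarrow> 'a :: comm_semiring_0"
  shows "(\<Sum>k<a * b. f (k div b) * g (k mod b)) = (\<Sum>i<a. f i) * (\<Sum>j<b. g j)"
  using sum_div_mod[of "\<lambda>i j. f i * g j" b a] by (simp add: sum_product)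

lemma div_mod_less: "k < a * b \<Longrightarrow> k div b < a \<and> k mod b < (b :: nat)"
  by (metis less_mult_imp_div_less mod_less_divisor mult_0_right not_gr_zero not_less_zero)

lemma kron_carrier:
  "A \<in> carrier_mat n m \<Longrightarrow> B \<in> carrier_mat n' m' \<Longrightarrow> kron A B \<in> carrier_mat (n * n') (m * m')"
  by (auto simp: kron_def)

text \<open>The summation index of the matrix product splits into quotient and remainder, and the
  sum factors accordingly.\<close>

lemma kron_mult:
  assumes "A \<in> carrier_mat a a" "B \<in> carrier_mat b b" "C \<in> carrier_mat a a" "D \<in> carrier_mat b b"
  shows "kron A B * kron C D = kron (A * C) (B * D)"
proof (rule eq_matI)
  fix i j assume "i < dim_row (kron (A * C) (B * D))" "j < dim_col (kron (A * C) (B * D))"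
  hence ij: "i < a * b" "j < a * b" using assms by (auto simp: kron_def)
  note dm = div_mod_less[OF ij(1)] div_mod_less[OF ij(2)]
  have "(kron A B * kron C D) $$ (i, j)
      = (\<Sum>k<a * b. kron A B $$ (i, k) * kron C D $$ (k, j))"
    using assms ij kron_carrier[OF assms(1,2)] kron_carrier[OF assms(3,4)]
    by (subst index_mult_sum) auto
  also have "\<dots> = (\<Sum>k<a * b. (A $$ (i div b, k div b) * C $$ (k div b, j div b)) *
        (B $$ (i mod b, k mod b) * D $$ (k mod b, j mod b)))"
    using assms ij by (intro sum.cong) (auto simp: kron_def)
  also have "\<dots> = (A * C) $$ (i div b, j div b) * (B * D) $$ (i mod b, j mod b)"
    using assms dm by (subst sum_div_mod_prod) (simp add: index_mult_sum del: index_mult_mat(1))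
  also have "\<dots> = kron (A * C) (B * D) $$ (i, j)"
    using assms ij by (simp add: kron_def)
  finally show "(kron A B * kron C D) $$ (i, j) = kron (A * C) (B * D) $$ (i, j)" .
qed (use assms in \<open>auto simp: kron_def\<close>)

lemma kron_adjoint:
  assumes "A \<in> carrier_mat a a" "B \<in> carrier_mat b b"
  shows "mat_adjoint (kron A B) = kron (mat_adjoint A) (mat_adjoint B)"
proof (rule eq_matI)
  fix i j assume "i < dim_row (kron (mat_adjoint A) (mat_adjoint B))"
    "j < dim_col (kron (mat_adjoint A) (mat_adjoint B))"
  hence ij: "i < a * b" "j < a * b" using assms by (auto simp: kron_def)
  thus "mat_adjoint (kron A B) $$ (i, j) = kron (mat_adjoint A) (mat_adjoint B) $$ (i, j)"
    using assms div_mod_less[OF ij(1)] div_mod_less[OF ij(2)] by (simp add: kron_def)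
qed (use assms in \<open>auto simp: kron_def\<close>)

lemma kron_rdiag: "kron (rdiag a f) (rdiag b g) = rdiag (a * b) (\<lambda>k. f (k div b) * g (k mod b))"
proof (rule eq_matI)
  fix i j assume "i < dim_row (rdiag (a * b) (\<lambda>k. f (k div b) * g (k mod b)))"
    "j < dim_col (rdiag (a * b) (\<lambda>k. f (k div b) * g (k mod b)))"
  hence ij: "i < a * b" "j < a * b" by auto
  have "i = j \<longleftrightarrow> i div b = j div b \<and> i mod b = j mod b"
    by (metis div_mult_mod_eq)
  thus "kron (rdiag a f) (rdiag b g) $$ (i, j) = rdiag (a * b) (\<lambda>k. f (k div b) * g (k mod b)) $$ (i, j)"
    using ij div_mod_less[OF ij(1)] div_mod_less[OF ij(2)] by (auto simp: kron_def mat_diag_def)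
qed (auto simp: kron_def)

lemma kron_one: "kron (1\<^sub>m a) (1\<^sub>m b) = 1\<^sub>m (a * b)"
  using kron_rdiag[of a "\<lambda>_. 1" b "\<lambda>_. 1"] by simp

lemma kron_unitary:
  assumes "unitary_mat a U" "unitary_mat b V"
  shows "unitary_mat (a * b) (kron U V)"
  using assms
  by (simp add: unitary_mat_def kron_carrier kron_adjoint[of _ a _ b] kron_mult[of _ a _ b] kron_one)

lemma kron_spectral:
  assumes "spectral a A U f" "spectral b B V g"
  shows "spectral (a * b) (kron A B) (kron U V) (\<lambda>k. f (k div b) * g (k mod b))"
proof -
  have U: "unitary_mat a U" "unitary_mat b V" using assms by (auto simp: spectral_def)
  note c = unitary_carrier[OF U(1)] unitary_carrier[OF U(2)]
  have "kron A B = kron U V * kron (rdiag a f) (rdiag b g) * mat_adjoint (kron U V)"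
    using assms c by (simp add: spectral_def kron_adjoint[of _ a _ b] kron_mult[of _ a _ b])
  thus ?thesis
    using kron_unitary[OF U] by (simp add: spectral_def kron_rdiag)
qed

text \<open>If \<open>p x\<close> lists the eigenvalues of \<open>W x\<close>, these are the
  eigenvalues of \<open>tensor_word W xs\<close>: the base \<open>d\<close> digits of
  \<open>k\<close>, most significant first, select one eigenvalue for each letter.\<close>

fun word_weight :: "nat \<Rightarrow> ('x \<Rightarrow> nat \<Rightarrow> real) \<Rightarrow> 'x list \<Rightarrow> nat \<Rightarrow> real" where
  "word_weight d p [] k = 1"
| "word_weight d p (x # xs) k = p x (k div d ^ length xs) * word_weight d p xs (k mod d ^ length xs)"

lemma tensor_word_spectral:
  assumes "\<And>x. spectral d (W x) (U x) (p x)"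
  shows "\<exists>V. spectral (d ^ length xs) (tensor_word W xs) V (word_weight d p xs)"
proof (induction xs)
  case Nil
  have "spectral 1 (tensor_word W []) (1\<^sub>m 1) (word_weight d p [])"
    by (simp add: spectral_def unitary_mat_def tensor_word_def)
  thus ?case unfolding list.size power_0 by blast
next
  case (Cons x xs)
  then obtain V where "spectral (d ^ length xs) (tensor_word W xs) V (word_weight d p xs)" by blast
  from kron_spectral[OF assms this, of x] show ?case
    by (auto simp: tensor_word_def)
qed

lemma word_weight_nonneg:
  assumes "\<And>x i. i < d \<Longrightarrow> p x i \<ge> 0" "k < d ^ length xs"
  shows "word_weight d p xs k \<ge> 0"
  using assms(2)
proof (induction xs arbitrary: k)
  case (Cons x xs)
  thus ?case using div_mod_less[of k d "d ^ length xs"] assms(1) by simp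
qed simp

text \<open>Independence of the letters: powers of a product distribution factor. With exponent
  \<open>1 - t\<close> this is the moment generating function of the information content.\<close>

lemma sum_word_weight_powr:
  assumes "\<And>x i. i < d \<Longrightarrow> p x i \<ge> 0"
  shows "(\<Sum>k<d ^ length xs. word_weight d p xs k powr t) = (\<Prod>x\<leftarrow>xs. \<Sum>i<d. p x i powr t)"
proof (induction xs)
  case (Cons x xs)
  have "(\<Sum>k<d ^ length (x # xs). word_weight d p (x # xs) k powr t)
     = (\<Sum>k<d * d ^ length xs. p x (k div d ^ length xs) powr t * word_weight d p xs (k mod d ^ length xs) powr t)"
    by (intro sum.cong) (auto simp: powr_mult)
  also have "\<dots> = (\<Sum>i<d. p x i powr t) * (\<Sum>k<d ^ length xs. word_weight d p xs k powr t)"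
    by (rule sum_div_mod_prod)
  finally show ?case using Cons.IH by simp
qed (simp add: lessThan_Suc)

lemma sum_word_weight:
  assumes "\<And>x. (\<Sum>i<d. p x i) = 1"
  shows "(\<Sum>k<d ^ length xs. word_weight d p xs k) = 1"
proof (induction xs)
  case (Cons x xs)
  thus ?case
    using sum_div_mod_prod[of "p x" "d ^ length xs" "word_weight d p xs" d] assms by simp
qed (simp add: lessThan_Suc)

section \<open>Additivity of the entropy over letters\<close>

abbreviation entropy_term :: "real \<Rightarrow> real" where
  "entropy_term t \<equiv> if t \<le> 0 then 0 else - t * log 2 t"

text \<open>A Leibniz rule, since the logarithm turns the product into a sum; the cases with a zero
  factor rely on the value \<open>0\<close> of the entropy term at \<open>0\<close>.\<close>

lemma entropy_term_mult:
  assumes "a \<ge> 0" "b \<ge> 0"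
  shows "entropy_term (a * b) = b * entropy_term a + a * entropy_term b"
  using assms by (cases "a = 0"; cases "b = 0") (auto simp: log_mult algebra_simps mult_le_0_iff)

text \<open>By the Leibniz rule the sum splits into two products, in each of which one factor is a
  total weight equal to \<open>1\<close>.\<close>

lemma sum_word_entropy:
  assumes p: "\<And>x i. i < d \<Longrightarrow> p x i \<ge> 0" "\<And>x. (\<Sum>i<d. p x i) = 1"
  shows "(\<Sum>k<d ^ length xs. entropy_term (word_weight d p xs k))
    = (\<Sum>x\<leftarrow>xs. \<Sum>i<d. entropy_term (p x i))"
proof (induction xs)
  case (Cons x xs)
  let ?b = "d ^ length xs" and ?w = "word_weight d p xs"
  have "(\<Sum>k<d ^ length (x # xs). entropy_term (word_weight d p (x # xs) k))
     = (\<Sum>k<d * ?b. entropy_term (p x (k div ?b)) * ?w (k mod ?b)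
        + p x (k div ?b) * entropy_term (?w (k mod ?b)))"
  proof (rule sum.cong)
    fix k assume "k \<in> {..<d * ?b}"
    hence "k div ?b < d" "k mod ?b < ?b" using div_mod_less[of k d ?b] by auto
    thus "entropy_term (word_weight d p (x # xs) k)
      = entropy_term (p x (k div ?b)) * ?w (k mod ?b) + p x (k div ?b) * entropy_term (?w (k mod ?b))"
      using entropy_term_mult[OF p(1) word_weight_nonneg[of d p "k mod ?b" xs, OF p(1)], of "k div ?b" x]
      by (simp only: word_weight.simps mult.commute)
  qed simp
  also have "\<dots> = (\<Sum>i<d. entropy_term (p x i)) * (\<Sum>k<?b. ?w k) + (\<Sum>i<d. p x i) * (\<Sum>k<?b. entropy_term (?w k))"
    unfolding sum.distrib
    by (simp only: sum_div_mod_prod[of "\<lambda>i. entropy_term (p x i)" ?b ?w d]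
        sum_div_mod_prod[of "p x" ?b "\<lambda>j. entropy_term (?w j)" d])
  finally show ?case using Cons.IH by (simp only: sum_word_weight[OF p(2)] p(2)) simp
qed (simp add: lessThan_Suc)

section \<open>Concentration of the information content\<close>

text \<open>In units \<open>z = X / L\<close> it suffices to bound
  \<open>z\<^sup>2 * exp (z / 24)\<close> by \<open>12 * exp (z - 2)\<close>. The factor
  \<open>1 + exp (X - L)\<close> is shaped for averaging: weighted by \<open>exp (- X)\<close> it
  becomes \<open>exp (- X) + exp (- L)\<close>, which sums to at most \<open>2\<close> over a
  distribution on at most \<open>exp L\<close> letters.\<close>

lemma square_exp_bound:
  fixes X L s :: real
  assumes L: "L \<ge> 1" and X: "X \<ge> 0" and s: "s \<le> 1 / (24 * L)"
  shows "X\<^sup>2 * exp (s * X) \<le> 12 * L\<^sup>2 * (1 + exp (X - L))"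
proof -
  define z where "z = X / L"
  have z: "z \<ge> 0" and XL: "X = L * z" using L X by (auto simp: z_def)
  have "s * X \<le> 1 / (24 * L) * X" using s X by (rule mult_right_mono)
  also have "\<dots> = z / 24" using L by (simp add: z_def)
  finally have sX: "exp (s * X) \<le> exp (z / 24)" by simp
  \<comment> \<open>The constant is half of \<open>23 / 24\<close>: after squaring, the exponent
    \<open>23 / 24 * z\<close> and the given \<open>z / 24\<close> add up to
    \<open>z\<close>.\<close>
  have "23 / 48 * z \<le> exp (23 / 48 * z - 1)"
    using exp_ge_add_one_self[of "23 / 48 * z - 1"] by simp
  hence "(23 / 48 * z)\<^sup>2 \<le> (exp (23 / 48 * z - 1))\<^sup>2"
    using z by (intro power_mono) auto
  also have "\<dots> = exp (23 / 24 * z - 2)"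
    by (simp add: power2_eq_square exp_add[symmetric])
  finally have "z\<^sup>2 \<le> (48 / 23)\<^sup>2 * exp (23 / 24 * z - 2)"
    by (simp add: power_mult_distrib power_divide field_simps)
  also have "\<dots> \<le> 12 * exp (23 / 24 * z - 2)"
    by (intro mult_right_mono) (auto simp: power2_eq_square)
  finally have "z\<^sup>2 * exp (z / 24) \<le> 12 * exp (23 / 24 * z - 2) * exp (z / 24)"
    by (intro mult_right_mono) auto
  also have "\<dots> = 12 * exp (z - 2)"
    by (simp add: exp_add[symmetric])
  \<comment> \<open>For \<open>z \<le> 1\<close> the summand \<open>1\<close> suffices; otherwise
    \<open>z - 2\<close> is below \<open>L * (z - 1) = X - L\<close>.\<close>
  also have "exp (z - 2) \<le> 1 + exp (X - L)"
  proof (cases "z \<le> 1")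
    case True
    hence "exp (z - 2) \<le> exp 0" by (subst exp_le_cancel_iff) simp
    thus ?thesis by (simp add: add_increasing2)
  next
    case False
    hence "z - 1 \<le> L * (z - 1)" using L by (simp add: mult_le_cancel_right1)
    hence "exp (z - 2) \<le> exp (X - L)" by (subst exp_le_cancel_iff) (simp add: XL algebra_simps)
    thus ?thesis by (intro add_increasing) auto
  qed
  finally have *: "z\<^sup>2 * exp (z / 24) \<le> 12 * (1 + exp (X - L))" by simp
  have "X\<^sup>2 * exp (s * X) \<le> X\<^sup>2 * exp (z / 24)"
    using sX by (intro mult_left_mono) auto
  also have "\<dots> = L\<^sup>2 * (z\<^sup>2 * exp (z / 24))" by (simp add: XL power_mult_distrib)
  also have "\<dots> \<le> L\<^sup>2 * (12 * (1 + exp (X - L)))"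
    using * by (intro mult_left_mono) auto
  finally show ?thesis by (simp only: mult_ac)
qed

text \<open>Taylor's formula of order two, with the intermediate point of the remainder replaced by
  the worst case.\<close>

lemma exp_le_quadratic: "exp y \<le> 1 + y + y\<^sup>2 / 2 * exp \<bar>y\<bar>" for y :: real
proof -
  obtain t where t: "\<bar>t\<bar> \<le> \<bar>y\<bar>" "exp y = (\<Sum>m<2. y ^ m / fact m) + exp t / fact 2 * y ^ 2"
    using Maclaurin_exp_le[of y 2] by blast
  have "exp t \<le> exp \<bar>y\<bar>" using t(1) by simp
  hence "exp t / fact 2 * y ^ 2 \<le> y\<^sup>2 / 2 * exp \<bar>y\<bar>"
    by (simp add: mult.commute mult_right_mono)
  thus ?thesis using t(2) by (simp add: eval_nat_numeral)
qed

text \<open>Writing \<open>l\<close> as \<open>exp (- X)\<close>, the left side is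
  \<open>l * exp (t * X)\<close>. In its second-order expansion the linear term is the entropy term
  and the remainder is controlled by \<open>square_exp_bound\<close>; \<open>exp (- L)\<close>
  arises from \<open>l * exp X = 1\<close>.\<close>

lemma powr_moment_bound:
  fixes l L t :: real
  assumes l: "0 \<le> l" "l \<le> 1" and L: "L \<ge> 1" and t: "\<bar>t\<bar> \<le> 1 / (24 * L)"
  shows "l powr (1 - t) \<le> l + t * ln 2 * entropy_term l + 6 * t\<^sup>2 * L\<^sup>2 * (l + exp (- L))"
proof (cases "l = 0")
  case False
  hence l0: "l > 0" using l by simp
  define X where "X = - ln l"
  have X: "X \<ge> 0" using l0 l by (simp add: X_def)
  have lX: "l * exp X = 1" using l0 by (simp add: X_def exp_minus)
  have "l powr (1 - t) = l * exp (t * X)"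
    using l0 by (simp add: powr_def X_def left_diff_distrib exp_diff exp_minus field_simps)
  also have "\<dots> \<le> l * (1 + t * X + (t * X)\<^sup>2 / 2 * exp \<bar>t * X\<bar>)"
    using l0 exp_le_quadratic by (intro mult_left_mono) auto
  also have "(t * X)\<^sup>2 / 2 * exp \<bar>t * X\<bar> = t\<^sup>2 / 2 * (X\<^sup>2 * exp (\<bar>t\<bar> * X))"
    using X by (simp add: power_mult_distrib abs_mult)
  also have "l * (1 + t * X + \<dots>) \<le> l * (1 + t * X + t\<^sup>2 / 2 * (12 * L\<^sup>2 * (1 + exp (X - L))))"
    using square_exp_bound[OF L X t] l0 by (intro mult_left_mono add_left_mono) auto
  also have "\<dots> = l + t * (l * X) + 6 * t\<^sup>2 * L\<^sup>2 * (l + (l * exp X) * exp (- L))"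
  proof -
    have "exp (X - L) = exp X * exp (- L)" by (simp add: exp_add[symmetric])
    thus ?thesis by (simp add: algebra_simps)
  qed
  also have "l * X = ln 2 * entropy_term l" using l0 by (simp add: X_def log_def)
  finally show ?thesis by (simp add: lX mult.assoc)
qed simp

text \<open>The left-hand side is the moment generating function, at \<open>t\<close>, of the information
  content \<open>- ln p\<close> under \<open>p\<close>.\<close>
lemma sum_powr_moment_bound:
  fixes p :: "nat \<Rightarrow> real" and L t :: real
  assumes p: "\<And>i. i < d \<Longrightarrow> p i \<ge> 0" "(\<Sum>i<d. p i) = 1"
    and L: "L \<ge> 1" "real d \<le> exp L" and t: "\<bar>t\<bar> \<le> 1 / (24 * L)"
  shows "(\<Sum>i<d. p i powr (1 - t)) \<le> exp (t * ln 2 * (\<Sum>i<d. entropy_term (p i)) + 12 * t\<^sup>2 * L\<^sup>2)"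
proof -
  have p1: "p i \<le> 1" if "i < d" for i
    using member_le_sum[of i "{..<d}" p] that p by auto
  have "(\<Sum>i<d. p i powr (1 - t))
      \<le> (\<Sum>i<d. p i + t * ln 2 * entropy_term (p i) + 6 * t\<^sup>2 * L\<^sup>2 * (p i + exp (- L)))"
    using p p1 L t by (intro sum_mono powr_moment_bound) auto
  also have "\<dots> = 1 + t * ln 2 * (\<Sum>i<d. entropy_term (p i)) + 6 * t\<^sup>2 * L\<^sup>2 * (1 + d * exp (- L))"
    by (simp only: sum.distrib sum_distrib_left[symmetric] p(2) sum_constant card_lessThan)
  \<comment> \<open>The choice of \<open>L\<close> gives
    \<open>d * exp (- L) \<le> 1\<close>.\<close>
  also have "\<dots> \<le> 1 + t * ln 2 * (\<Sum>i<d. entropy_term (p i)) + 6 * t\<^sup>2 * L\<^sup>2 * 2"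
    using L(2) by (intro add_left_mono mult_left_mono) (auto simp: exp_minus field_simps)
  also have "\<dots> = 1 + (t * ln 2 * (\<Sum>i<d. entropy_term (p i)) + 12 * t\<^sup>2 * L\<^sup>2)"
    by simp
  also have "\<dots> \<le> exp (t * ln 2 * (\<Sum>i<d. entropy_term (p i)) + 12 * t\<^sup>2 * L\<^sup>2)"
    by (rule exp_ge_add_one_self)
  finally show ?thesis .
qed

text \<open>The moment generating function is a product over the letters, so the exponents of the
  single-letter bounds add up; the linear parts add to the entropy of the word.\<close>

lemma sum_word_powr_moment_bound:
  fixes p :: "'x \<Rightarrow> nat \<Rightarrow> real" and L t :: real
  assumes p: "\<And>x i. i < d \<Longrightarrow> p x i \<ge> 0" "\<And>x. (\<Sum>i<d. p x i) = 1"
    and L: "L \<ge> 1" "real d \<le> exp L" and t: "\<bar>t\<bar> \<le> 1 / (24 * L)"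
  shows "(\<Sum>k<d ^ length xs. word_weight d p xs k powr (1 - t))
    \<le> exp (t * ln 2 * (\<Sum>k<d ^ length xs. entropy_term (word_weight d p xs k))
        + 12 * length xs * t\<^sup>2 * L\<^sup>2)"
proof -
  \<comment> \<open>Nonnegativity is carried through the induction because multiplying the bounds
    requires it.\<close>
  have "(\<Prod>x\<leftarrow>xs. \<Sum>i<d. p x i powr (1 - t))
    \<le> exp (t * ln 2 * (\<Sum>x\<leftarrow>xs. \<Sum>i<d. entropy_term (p x i)) + 12 * length xs * t\<^sup>2 * L\<^sup>2)
    \<and> 0 \<le> (\<Prod>x\<leftarrow>xs. \<Sum>i<d. p x i powr (1 - t))"
  proof (induction xs)
    case (Cons x xs)
    have 0: "0 \<le> (\<Sum>i<d. p x i powr (1 - t))" by (intro sum_nonneg) simp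
    have "(\<Prod>x\<leftarrow>x # xs. \<Sum>i<d. p x i powr (1 - t))
      \<le> exp (t * ln 2 * (\<Sum>i<d. entropy_term (p x i)) + 12 * t\<^sup>2 * L\<^sup>2)
       * exp (t * ln 2 * (\<Sum>x\<leftarrow>xs. \<Sum>i<d. entropy_term (p x i)) + 12 * length xs * t\<^sup>2 * L\<^sup>2)"
      unfolding list.map prod_list.Cons
      using Cons.IH 0 sum_powr_moment_bound[of d "p x", OF p(1) p(2) L t]
      by (intro mult_mono) auto
    also have "\<dots> = exp (t * ln 2 * (\<Sum>x\<leftarrow>x # xs. \<Sum>i<d. entropy_term (p x i)) + 12 * length (x # xs) * t\<^sup>2 * L\<^sup>2)"
      unfolding list.map sum_list.Cons by (simp only: exp_add[symmetric]) (simp add: algebra_simps)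
    finally show ?case using 0 Cons.IH by simp
  qed simp
  thus ?thesis
    by (simp only: sum_word_weight_powr[OF p(1)] sum_word_entropy[OF p])
qed

text \<open>Markov's inequality for the exponential: on the tail, \<open>w k powr (- t)\<close>
  times \<open>exp (- t * ln 2 * S - y)\<close> is at least \<open>1\<close>. The sign of
  \<open>t\<close> selects the upper or the lower tail.\<close>

lemma chernoff_tail:
  fixes w :: "nat \<Rightarrow> real"
  assumes I: "finite I" and w: "\<And>k. k \<in> I \<Longrightarrow> w k \<ge> 0"
    and m: "(\<Sum>k\<in>I. w k powr (1 - t)) \<le> exp (t * ln 2 * S + c)"
  shows "(\<Sum>k\<in>{k\<in>I. w k > 0 \<and> t * ln 2 * (- log 2 (w k) - S) \<ge> y}. w k) \<le> exp (c - y)"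
proof -
  let ?J = "{k\<in>I. w k > 0 \<and> t * ln 2 * (- log 2 (w k) - S) \<ge> y}"
  have "(\<Sum>k\<in>?J. w k) \<le> (\<Sum>k\<in>?J. w k powr (1 - t) * exp (- t * ln 2 * S - y))"
  proof (rule sum_mono)
    fix k assume k: "k \<in> ?J"
    have "w k powr (1 - t) * exp (- t * ln 2 * S - y) = w k * exp (t * ln 2 * (- log 2 (w k) - S) - y)"
      using k by (simp add: powr_def log_def exp_add[symmetric] exp_diff[symmetric] ring_distribs)
        (simp add: exp_diff exp_add exp_minus field_simps)
    moreover have "1 \<le> exp (t * ln 2 * (- log 2 (w k) - S) - y)" using k by simp
    ultimately show "w k \<le> w k powr (1 - t) * exp (- t * ln 2 * S - y)"
      using k by (simp add: mult_le_cancel_left1)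
  qed
  also have "\<dots> = (\<Sum>k\<in>?J. w k powr (1 - t)) * exp (- t * ln 2 * S - y)"
    by (simp add: sum_distrib_right)
  also have "\<dots> \<le> (\<Sum>k\<in>I. w k powr (1 - t)) * exp (- t * ln 2 * S - y)"
    using I by (intro mult_right_mono sum_mono2) auto
  also have "\<dots> \<le> exp (t * ln 2 * S + c) * exp (- t * ln 2 * S - y)"
    using m by (intro mult_right_mono) auto
  also have "\<dots> = exp (c - y)" by (simp add: exp_add[symmetric])
  finally show ?thesis .
qed

section \<open>The weight outside the typical set\<close>

lemma ln_2_le_three_quarters: "ln 2 \<le> (3 / 4 :: real)"
proof -
  have "2 \<le> exp (3 / 4 :: real)"
    using exp_lower_Taylor_quadratic[of "3 / 4 :: real"] by (simp add: power2_eq_square)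
  hence "ln 2 \<le> ln (exp (3 / 4 :: real))" by (subst ln_le_cancel_iff) auto
  thus ?thesis by simp
qed

lemma K_const_ln:
  assumes "L = ln (real (max d 3))"
  shows "K_const d = (L / ln 2)\<^sup>2"
  by (simp add: K_const_def log_def assms)

text \<open>Two Chernoff bounds, one for each direction of deviation, which explains the factor
  \<open>2\<close>.\<close>

lemma nontypical_weight:
  fixes p :: "'x \<Rightarrow> nat \<Rightarrow> real"
  assumes p: "\<And>x i. i < d \<Longrightarrow> p x i \<ge> 0" "\<And>x. (\<Sum>i<d. p x i) = 1"
    and n: "length xs = n" "n \<ge> 1" and d: "d \<ge> 1"
    and \<delta>: "0 < \<delta>" "\<delta> \<le> sqrt (real n) * log 2 (real d)"
  defines "w \<equiv> word_weight d p xs"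
  defines "S \<equiv> \<Sum>k<d ^ n. entropy_term (w k)"
  shows "(\<Sum>k\<in>{k. k < d ^ n \<and> \<not> (w k > 0 \<and> S - \<delta> * sqrt n \<le> - log 2 (w k) \<and> - log 2 (w k) \<le> S + \<delta> * sqrt n)}. w k)
    \<le> 2 * 2 powr (- (\<delta>\<^sup>2 / (36 * K_const d)))"
proof -
  \<comment> \<open>The lower limit \<open>3\<close> exceeds Euler's number and thus ensures
    \<open>L \<ge> 1\<close>.\<close>
  define L where "L = ln (real (max d 3))"
  have "exp 1 \<le> (3 :: real)" by (rule exp_le)
  hence "1 \<le> ln (3 :: real)" using ln_ge_iff[of 3 1] by simp
  also have "\<dots> \<le> L" by (simp add: L_def)
  finally have L: "L \<ge> 1" .
  have dL: "real d \<le> exp L" by (simp add: L_def)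
  have lnd: "ln (real d) \<le> L" using d by (simp add: L_def)
  define b where "b = ln 2 * (\<delta> * sqrt n)"
  have b0: "b > 0" using \<delta> n by (simp add: b_def)
  \<comment> \<open>The upper bound on \<open>\<delta>\<close> leads to
    \<open>b \<le> n * L\<close>, which keeps \<open>\<tau>\<close> in the range where the moment
    bound holds.\<close>
  have "\<delta> * sqrt n \<le> (sqrt n * log 2 d) * sqrt n"
    using \<delta> by (intro mult_right_mono) auto
  hence "b \<le> ln 2 * (sqrt n * log 2 d * sqrt n)"
    unfolding b_def by (intro mult_left_mono) auto
  also have "\<dots> = n * ln d" by (simp add: log_def)
  also have "\<dots> \<le> n * L" using lnd by (intro mult_left_mono) auto
  finally have b: "b \<le> n * L" .
  \<comment> \<open>The minimiser of the exponent
    \<open>12 * n * t\<^sup>2 * L\<^sup>2 - t * b\<close>; the minimum is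
    \<open>- b\<^sup>2 / (48 * n * L\<^sup>2)\<close>.\<close>
  define \<tau> where "\<tau> = b / (24 * n * L\<^sup>2)"
  have nL: "n * L\<^sup>2 > 0" using n L by auto
  have \<tau>0: "\<tau> > 0" using b0 nL by (simp add: \<tau>_def)
  have "\<tau> \<le> n * L / (24 * n * L\<^sup>2)"
    unfolding \<tau>_def using b nL by (intro divide_right_mono) auto
  also have "\<dots> = 1 / (24 * L)" using n L by (simp add: field_simps power2_eq_square)
  finally have \<tau>: "\<tau> \<le> 1 / (24 * L)" .
  have w0: "w k \<ge> 0" if "k < d ^ n" for k
    using word_weight_nonneg[of d p k xs] p(1) that n by (simp add: w_def)
  have tail: "(\<Sum>k\<in>{k \<in> {..<d ^ n}. w k > 0 \<and> t * ln 2 * (- log 2 (w k) - S) \<ge> \<tau> * b}. w k)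
      \<le> 2 powr (- (\<delta>\<^sup>2 / (36 * K_const d)))" if t: "\<bar>t\<bar> = \<tau>" for t
  proof -
    have t2: "t\<^sup>2 = \<tau>\<^sup>2" using t by (metis power2_abs)
    have "(\<Sum>k\<in>{k \<in> {..<d ^ n}. w k > 0 \<and> t * ln 2 * (- log 2 (w k) - S) \<ge> \<tau> * b}. w k)
      \<le> exp (12 * n * t\<^sup>2 * L\<^sup>2 - \<tau> * b)"
    proof (rule chernoff_tail)
      show "(\<Sum>k<d ^ n. w k powr (1 - t)) \<le> exp (t * ln 2 * S + 12 * n * t\<^sup>2 * L\<^sup>2)"
        using sum_word_powr_moment_bound[where p = p and t = t and xs = xs, OF p L dL] \<tau> t
        unfolding w_def S_def n(1)[symmetric] by blast
    qed (use w0 in auto)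
    also have "12 * n * t\<^sup>2 * L\<^sup>2 - \<tau> * b = - (b\<^sup>2 / (48 * n * L\<^sup>2))"
      using nL n L unfolding t2 \<tau>_def by (simp add: field_simps power2_eq_square)
    \<comment> \<open>The factors \<open>ln 2\<close> in \<open>b\<close> and in the base-2
      logarithm of \<open>K_const\<close> cancel.\<close>
    also have "b\<^sup>2 / (48 * n * L\<^sup>2) = \<delta>\<^sup>2 / (48 * K_const d)"
      using n L by (simp add: b_def K_const_ln[OF L_def] power_mult_distrib power_divide field_simps)
    \<comment> \<open>The change to base 2 improves the constant from \<open>48\<close> to
      \<open>36\<close>, as \<open>ln 2\<close> is at most \<open>36 / 48\<close>.\<close>
    also have "exp (- (\<delta>\<^sup>2 / (48 * K_const d))) \<le> exp (- (\<delta>\<^sup>2 / (36 * K_const d)) * ln 2)"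
    proof -
      have K: "K_const d \<ge> 0" by (simp add: K_const_def)
      have "\<delta>\<^sup>2 / (36 * K_const d) * ln 2 \<le> \<delta>\<^sup>2 / (36 * K_const d) * (3 / 4)"
        using K ln_2_le_three_quarters by (intro mult_left_mono) auto
      thus ?thesis by simp
    qed
    also have "\<dots> = 2 powr (- (\<delta>\<^sup>2 / (36 * K_const d)))" by (simp add: powr_def)
    finally show ?thesis .
  qed
  let ?bad = "{k. k < d ^ n \<and> \<not> (w k > 0 \<and> S - \<delta> * sqrt n \<le> - log 2 (w k) \<and> - log 2 (w k) \<le> S + \<delta> * sqrt n)}"
  let ?T = "\<lambda>t. {k \<in> {..<d ^ n}. w k > 0 \<and> t * ln 2 * (- log 2 (w k) - S) \<ge> \<tau> * b}"
  \<comment> \<open>Eigenvalue zero counts as nontypical but carries no weight.\<close>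
  have "(\<Sum>k\<in>?bad. w k) = (\<Sum>k\<in>{k \<in> ?bad. w k > 0}. w k)"
    using w0 by (intro sum.mono_neutral_right) (auto simp: order.order_iff_strict)
  also have "\<dots> \<le> (\<Sum>k\<in>?T \<tau> \<union> ?T (- \<tau>). w k)"
  proof (rule sum_mono2)
    show "{k \<in> ?bad. w k > 0} \<subseteq> ?T \<tau> \<union> ?T (- \<tau>)"
    proof
      fix k assume k: "k \<in> {k \<in> ?bad. w k > 0}"
      then consider "- log 2 (w k) - S \<ge> \<delta> * sqrt n" | "- (- log 2 (w k) - S) \<ge> \<delta> * sqrt n"
        by force
      thus "k \<in> ?T \<tau> \<union> ?T (- \<tau>)"
      proof cases
        case 1
        hence "\<tau> * ln 2 * (\<delta> * sqrt n) \<le> \<tau> * ln 2 * (- log 2 (w k) - S)"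
          using \<tau>0 by (intro mult_left_mono) auto
        thus ?thesis using k by (simp add: b_def mult.assoc)
      next
        case 2
        hence "\<tau> * ln 2 * (\<delta> * sqrt n) \<le> \<tau> * ln 2 * (- (- log 2 (w k) - S))"
          using \<tau>0 by (intro mult_left_mono) auto
        hence "\<tau> * b \<le> - \<tau> * ln 2 * (- log 2 (w k) - S)" by (simp add: b_def algebra_simps)
        thus ?thesis using k by simp
      qed
    qed
  qed (use w0 in auto)
  also have "\<dots> \<le> (\<Sum>k\<in>?T \<tau>. w k) + (\<Sum>k\<in>?T (- \<tau>). w k)"
    using w0 by (subst sum.union_inter[symmetric]) (auto intro!: sum_nonneg)
  also have "\<dots> \<le> 2 * 2 powr (- (\<delta>\<^sup>2 / (36 * K_const d)))"
    using tail[of \<tau>] tail[of "- \<tau>"] \<tau>0 by simp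
  finally show ?thesis .
qed

section \<open>Range of the entropy\<close>

lemma word_entropy_bounds:
  fixes p :: "'x \<Rightarrow> nat \<Rightarrow> real"
  assumes p: "\<And>x i. i < d \<Longrightarrow> p x i \<ge> 0" "\<And>x. (\<Sum>i<d. p x i) = 1"
  shows "0 \<le> (\<Sum>x\<leftarrow>xs. \<Sum>i<d. entropy_term (p x i))"
    "(\<Sum>x\<leftarrow>xs. \<Sum>i<d. entropy_term (p x i)) \<le> length xs * log 2 d"
proof -
  \<comment> \<open>Here \<open>undefined\<close> stands for an arbitrary letter: an empty sum of
    weights could not be \<open>1\<close>.\<close>
  have d: "d > 0" using p(2)[of undefined] by (cases "d = 0") auto
  have 0: "0 \<le> (\<Sum>i<d. entropy_term (p x i))" for x
  proof (rule sum_nonneg)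
    fix i assume "i \<in> {..<d}"
    hence "p x i \<le> 1" using member_le_sum[of i "{..<d}" "p x"] p by auto
    thus "0 \<le> entropy_term (p x i)" by (auto simp: mult_le_0_iff)
  qed
  have 1: "(\<Sum>i<d. entropy_term (p x i)) \<le> log 2 d" for x
  proof -
    \<comment> \<open>Nonnegativity of the relative entropy to the uniform distribution, term by
      term: \<open>ln y \<le> y - 1\<close> at \<open>y = 1 / (d * l)\<close>. The corrections
      \<open>1 / d - l\<close> cancel in the sum over the letter's eigenvalues.\<close>
    have "ln 2 * entropy_term l \<le> l * ln d + (1 / d - l)" if l: "l \<ge> 0" for l
    proof (cases "l = 0")
      case False
      hence l0: "l > 0" using l by simp
      have "l * ln (1 / (d * l)) \<le> l * (1 / (d * l) - 1)"
        using l0 d by (intro mult_left_mono ln_le_minus_one) auto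
      thus ?thesis using l0 d by (simp add: log_def ln_div ln_mult algebra_simps)
    qed simp
    hence "(\<Sum>i<d. ln 2 * entropy_term (p x i)) \<le> (\<Sum>i<d. p x i * ln d + (1 / d - p x i))"
      using p(1) by (intro sum_mono) blast
    also have "\<dots> = ln d"
      using d by (simp add: sum.distrib sum_subtractf sum_distrib_right[symmetric] p(2))
    finally have "ln 2 * (\<Sum>i<d. entropy_term (p x i)) \<le> ln d"
      by (simp only: sum_distrib_left)
    thus ?thesis by (simp add: log_def field_simps)
  qed
  show "0 \<le> (\<Sum>x\<leftarrow>xs. \<Sum>i<d. entropy_term (p x i))"
    using 0 by (intro sum_list_nonneg) auto
  show "(\<Sum>x\<leftarrow>xs. \<Sum>i<d. entropy_term (p x i)) \<le> length xs * log 2 d"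
  proof (induction xs)
    case (Cons x xs)
    thus ?case using 1[of x] unfolding list.map sum_list.Cons by (simp only: list.size) (simp add: algebra_simps)
  qed simp
qed

section \<open>Projections and state discrimination\<close>

definition sq_norm :: "complex vec \<Rightarrow> real" where
  "sq_norm v = (\<Sum>i<dim_vec v. (cmod (v $ i))\<^sup>2)"

lemma sq_norm_nonneg [simp]: "sq_norm v \<ge> 0"
  by (simp add: sq_norm_def sum_nonneg)

lemma sprod_self: "v \<bullet>c v = complex_of_real (sq_norm v)"
  by (simp add: csquare_norm_vec sq_norm_def)

lemma sq_norm_add_le:
  assumes "v \<in> carrier_vec n" "w \<in> carrier_vec n"
  shows "sq_norm (v + w) \<le> 2 * sq_norm v + 2 * sq_norm w"
proof -
  have "(cmod (a + b))\<^sup>2 \<le> 2 * (cmod a)\<^sup>2 + 2 * (cmod b)\<^sup>2" for a b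
  proof -
    have "(cmod (a + b))\<^sup>2 \<le> (cmod a + cmod b)\<^sup>2"
      by (intro power_mono norm_triangle_ineq) auto
    also have "\<dots> \<le> 2 * (cmod a)\<^sup>2 + 2 * (cmod b)\<^sup>2"
      using sum_squares_bound[of "cmod a" "cmod b"] by (simp add: power2_sum)
    finally show ?thesis .
  qed
  hence "(\<Sum>i<n. (cmod (v $ i + w $ i))\<^sup>2) \<le> (\<Sum>i<n. 2 * (cmod (v $ i))\<^sup>2 + 2 * (cmod (w $ i))\<^sup>2)"
    by (rule sum_mono)
  thus ?thesis using assms by (simp add: sq_norm_def sum.distrib sum_distrib_left)
qed

definition is_proj :: "nat \<Rightarrow> complex mat \<Rightarrow> bool" where
  "is_proj m Q \<longleftrightarrow> Q \<in> carrier_mat m m \<and> mat_adjoint Q = Q \<and> Q * Q = Q"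

text \<open>By idempotence \<open>Q\<close> may be applied twice, and self-adjointness moves one
  copy to the other side of the inner product.\<close>

lemma proj_form:
  assumes Q: "is_proj m Q" and v: "v \<in> carrier_vec m"
  shows "(Q *\<^sub>v v) \<bullet>c v = complex_of_real (sq_norm (Q *\<^sub>v v))"
proof -
  have c: "Q \<in> carrier_mat m m" and Qv: "Q *\<^sub>v v \<in> carrier_vec m"
    using Q v by (auto simp: is_proj_def)
  have "Q *\<^sub>v v = Q *\<^sub>v (Q *\<^sub>v v)"
    using Q v assoc_mult_mat_vec[OF c c v] by (simp add: is_proj_def)
  hence "(Q *\<^sub>v v) \<bullet>c v = (Q *\<^sub>v (Q *\<^sub>v v)) \<bullet>c v" by simp
  also have "\<dots> = (Q *\<^sub>v v) \<bullet>c (Q *\<^sub>v v)"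
    using adjoint_sprod[OF c Qv v] Q by (simp add: is_proj_def)
  finally show ?thesis by (simp add: sprod_self)
qed

lemma one_minus_mult_vec:
  fixes Q :: "complex mat"
  assumes "Q \<in> carrier_mat m m" "v \<in> carrier_vec m"
  shows "(1\<^sub>m m - Q) *\<^sub>v v = v - Q *\<^sub>v v"
  using assms minus_mult_distrib_mat_vec[of "1\<^sub>m m" m m Q v] by simp

lemma proj_complement:
  assumes "is_proj m Q"
  shows "is_proj m (1\<^sub>m m - Q)"
proof -
  have c: "Q \<in> carrier_mat m m" "mat_adjoint Q = Q" "Q * Q = Q" using assms by (auto simp: is_proj_def)
  have "(1\<^sub>m m - Q) * (1\<^sub>m m - Q) = 1\<^sub>m m * (1\<^sub>m m - Q) - Q * (1\<^sub>m m - Q)"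
    using c by (intro minus_mult_distrib_mat) auto
  also have "Q * (1\<^sub>m m - Q) = Q * 1\<^sub>m m - Q * Q"
    using c by (intro mult_minus_distrib_mat) auto
  also have "1\<^sub>m m * (1\<^sub>m m - Q) - (Q * 1\<^sub>m m - Q * Q) = 1\<^sub>m m - Q"
    using c(1) by (intro eq_matI) (auto simp: c(3))
  finally show ?thesis
    using c minus_carrier_mat[of Q m m "1\<^sub>m m"] by (simp add: is_proj_def adjoint_minus[of _ m m])
qed

text \<open>Pythagoras, read off from the quadratic forms of two complementary projections.\<close>

lemma proj_split:
  assumes "is_proj m Q" "v \<in> carrier_vec m"
  shows "sq_norm v = sq_norm (Q *\<^sub>v v) + sq_norm ((1\<^sub>m m - Q) *\<^sub>v v)"
proof -
  have c: "Q \<in> carrier_mat m m" using assms by (auto simp: is_proj_def)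
  hence Qv: "Q *\<^sub>v v \<in> carrier_vec m" using assms by auto
  have "((1\<^sub>m m - Q) *\<^sub>v v) \<bullet>c v = v \<bullet>c v - (Q *\<^sub>v v) \<bullet>c v"
    unfolding one_minus_mult_vec[OF c assms(2)]
    using assms(2) Qv by (intro minus_scalar_prod_distrib) auto
  hence "complex_of_real (sq_norm ((1\<^sub>m m - Q) *\<^sub>v v))
     = complex_of_real (sq_norm v - sq_norm (Q *\<^sub>v v))"
    by (simp only: proj_form[OF assms] proj_form[OF proj_complement[OF assms(1)] assms(2)] sprod_self of_real_diff)
  thus ?thesis by (simp only: of_real_eq_iff)
qed

lemma proj_contraction:
  assumes "is_proj m Q" "v \<in> carrier_vec m"
  shows "sq_norm (Q *\<^sub>v v) \<le> sq_norm v"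
  using proj_split[OF assms] by simp

text \<open>The pinching inequality \<open>Q \<le> 2 T Q T + 2 (1 - T)\<close> as a statement on quadratic forms.\<close>
lemma proj_pinching:
  assumes Q: "is_proj m Q" and T: "is_proj m T" and v: "v \<in> carrier_vec m"
  shows "sq_norm (Q *\<^sub>v v) \<le> 2 * sq_norm (Q *\<^sub>v (T *\<^sub>v v)) + 2 * sq_norm ((1\<^sub>m m - T) *\<^sub>v v)"
proof -
  have c: "Q \<in> carrier_mat m m" "T \<in> carrier_mat m m" using Q T by (auto simp: is_proj_def)
  have Tv: "T *\<^sub>v v \<in> carrier_vec m" using c v by auto
  have T'v: "(1\<^sub>m m - T) *\<^sub>v v \<in> carrier_vec m" unfolding one_minus_mult_vec[OF c(2) v] using Tv v by auto
  \<comment> \<open>The vector is split along \<open>T\<close> before \<open>Q\<close> is applied;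
    the cross terms are absorbed by \<open>sq_norm_add_le\<close> at the price of the factors
    \<open>2\<close>.\<close>
  have "v = T *\<^sub>v v + (1\<^sub>m m - T) *\<^sub>v v"
    unfolding one_minus_mult_vec[OF c(2) v] using Tv v c(2) by (intro eq_vecI) auto
  hence "Q *\<^sub>v v = Q *\<^sub>v (T *\<^sub>v v) + Q *\<^sub>v ((1\<^sub>m m - T) *\<^sub>v v)"
    using mult_add_distrib_mat_vec[OF c(1) Tv T'v] by simp
  hence "sq_norm (Q *\<^sub>v v) \<le> 2 * sq_norm (Q *\<^sub>v (T *\<^sub>v v)) + 2 * sq_norm (Q *\<^sub>v ((1\<^sub>m m - T) *\<^sub>v v))"
    using sq_norm_add_le[OF mult_mat_vec_carrier[OF c(1) Tv] mult_mat_vec_carrier[OF c(1) T'v]] by simp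
  also have "sq_norm (Q *\<^sub>v ((1\<^sub>m m - T) *\<^sub>v v)) \<le> sq_norm ((1\<^sub>m m - T) *\<^sub>v v)"
    by (rule proj_contraction[OF Q T'v])
  finally show ?thesis by simp
qed

section \<open>Spectral projections, Helstrom's test and overlaps\<close>

lemma spectral_proj:
  assumes "spectral m Q V q" "\<And>k. q k = 0 \<or> q k = 1"
  shows "is_proj m Q"
proof -
  have "q k * q k = q k" for k using assms(2)[of k] by auto
  hence "(\<lambda>k. q k * q k) = q" by (rule ext)
  hence "spectral m (Q * Q) V q" using spectral_mult[OF assms(1,1)] by simp
  hence "Q * Q = Q" using assms(1) by (simp add: spectral_def)
  thus ?thesis
    using spectral_carrier[OF assms(1)] spectral_adjoint[OF assms(1)] by (simp add: is_proj_def)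
qed

lemma spectral_one_minus:
  assumes "spectral m A U e"
  shows "spectral m (1\<^sub>m m - A) U (\<lambda>i. 1 - e i)"
proof -
  have U: "unitary_mat m U" and A: "A = U * rdiag m e * mat_adjoint U"
    using assms by (auto simp: spectral_def)
  note c = unitary_carrier[OF U]
  have "rdiag m (\<lambda>i. 1 - e i) = 1\<^sub>m m - rdiag m e"
    by (intro eq_matI) (auto simp: mat_diag_def)
  hence "U * rdiag m (\<lambda>i. 1 - e i) * mat_adjoint U = (U * 1\<^sub>m m - U * rdiag m e) * mat_adjoint U"
    using c mult_minus_distrib_mat[of U m m "1\<^sub>m m" m "rdiag m e"] by simp
  also have "\<dots> = U * 1\<^sub>m m * mat_adjoint U - U * rdiag m e * mat_adjoint U"
    using c by (intro minus_mult_distrib_mat) auto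
  finally show ?thesis using U c by (simp add: spectral_def A unitary_right[OF U])
qed

lemma spectral_effect:
  assumes "spectral m Q V q" "\<And>k. q k = 0 \<or> q k = 1"
  shows "effect_op m Q"
proof -
  have "0 \<le> q k" "0 \<le> 1 - q k" for k using assms(2)[of k] by auto
  thus ?thesis
    using spectral_psd[OF assms(1)] spectral_psd[OF spectral_one_minus[OF assms(1)]]
      spectral_carrier[OF assms(1)] by (auto simp: effect_op_def)
qed

lemma mtrace_spectral_proj:
  assumes A: "spectral m A U e" and Q: "is_proj m Q"
  shows "mtrace (A * Q) = complex_of_real (\<Sum>i<m. e i * sq_norm (Q *\<^sub>v col U i))"
proof -
  have U: "U \<in> carrier_mat m m" using A by (auto simp: spectral_def unitary_mat_def)
  have "(Q *\<^sub>v col U i) \<bullet>c col U i = complex_of_real (sq_norm (Q *\<^sub>v col U i))" if "i < m" for i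
    using proj_form[OF Q] U that by auto
  moreover have "Q \<in> carrier_mat m m" using Q by (simp add: is_proj_def)
  ultimately show ?thesis by (simp add: mtrace_spectral_mult[OF A])
qed

text \<open>Helstrom's test: project onto the positive part of the difference of the two states.\<close>
lemma helstrom_test:
  assumes \<rho>: "spectral m \<rho> U r" "(\<Sum>i<m. r i) = 1" and \<sigma>: "spectral m \<sigma> V s" "(\<Sum>i<m. s i) = 1"
  shows "\<exists>T. is_proj m T \<and> Re (mtrace (\<rho> * T)) - Re (mtrace (\<sigma> * T)) = trace_norm (\<rho> - \<sigma>) / 2"
proof -
  define D where "D = \<rho> - \<sigma>"
  note c = spectral_carrier[OF \<rho>(1)] spectral_carrier[OF \<sigma>(1)]
  have D: "D \<in> carrier_mat m m" using c by (auto simp: D_def)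
  have Da: "mat_adjoint D = D"
    using c by (simp add: D_def adjoint_minus[of _ m m] spectral_adjoint[OF \<rho>(1)] spectral_adjoint[OF \<sigma>(1)])
  from spectral_theorem[OF D Da] obtain X g where X: "spectral m D X g" by blast
  define T where "T = mat_fun (\<lambda>t. if t > 0 then 1 else 0) D"
  have sT: "spectral m T X (\<lambda>i. if g i > 0 then 1 else 0)"
    unfolding T_def by (rule spectral_mat_fun[OF X])
  have T: "is_proj m T" by (rule spectral_proj[OF sT]) auto
  have "complex_of_real (\<Sum>i<m. g i) = 0"
    using mtrace_spectral[OF X] mtrace_spectral[OF \<rho>(1)] mtrace_spectral[OF \<sigma>(1)] mtrace_minus[OF c]
      \<rho>(2) \<sigma>(2) unfolding D_def by (simp flip: of_real_sum)
  hence g0: "(\<Sum>i<m. g i) = 0" by (simp only: of_real_eq_0_iff)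
  have "spectral m (mat_fun sqrt (D * D)) X (\<lambda>i. sqrt (g i * g i))"
    by (rule spectral_mat_fun[OF spectral_mult[OF X X]])
  hence "trace_norm D = (\<Sum>i<m. \<bar>g i\<bar>)"
    unfolding trace_norm_def Da by (simp add: mtrace_spectral flip: of_real_sum)
  \<comment> \<open>An absolute value is twice the positive part minus the number itself. As
    \<open>D\<close> has trace zero, the trace norm is twice the sum of the positive
    eigenvalues.\<close>
  also have "\<dots> = (\<Sum>i<m. 2 * (g i * (if g i > 0 then 1 else 0)) - g i)"
    by (intro sum.cong) auto
  also have "\<dots> = 2 * (\<Sum>i<m. g i * (if g i > 0 then 1 else 0))"
    by (simp add: sum_subtractf g0 sum_distrib_left)
  also have "(\<Sum>i<m. g i * (if g i > 0 then 1 else 0)) = Re (mtrace (D * T))"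
    using mtrace_spectral[OF spectral_mult[OF X sT]] by simp
  also have "D * T = \<rho> * T - \<sigma> * T"
    unfolding D_def using c T by (intro minus_mult_distrib_mat) (auto simp: is_proj_def)
  also have "mtrace \<dots> = mtrace (\<rho> * T) - mtrace (\<sigma> * T)"
    using c T by (intro mtrace_minus) (auto simp: is_proj_def)
  finally have "Re (mtrace (\<rho> * T)) - Re (mtrace (\<sigma> * T)) = trace_norm (\<rho> - \<sigma>) / 2"
    by (simp add: D_def)
  thus ?thesis using T by blast
qed

text \<open>Helstrom's test \<open>T\<close> has error probabilities at most \<open>\<epsilon>\<close>, so the pinching terms
  contribute at most \<open>2 c1 tr (T Q T) \<le> 2 c1 c2 tr (\<sigma> T)\<close> and \<open>2 tr (\<rho> (1 - T))\<close>.\<close>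
lemma overlap_bound:
  assumes \<rho>: "spectral m \<rho> U r" "(\<Sum>i<m. r i) = 1" "\<And>i. i < m \<Longrightarrow> r i \<ge> 0"
    and \<sigma>: "spectral m \<sigma> V s" "(\<Sum>i<m. s i) = 1" "\<And>i. i < m \<Longrightarrow> s i \<ge> 0"
    and Q: "spectral m Q V q" "\<And>k. q k = 0 \<or> q k = 1"
    and dist: "1 - trace_norm (\<rho> - \<sigma>) / 2 \<le> \<epsilon>"
    and P: "\<And>i. i < m \<Longrightarrow> P i \<Longrightarrow> r i \<le> c1" and c1: "c1 \<ge> 0"
    and qs: "\<And>k. k < m \<Longrightarrow> q k = 1 \<Longrightarrow> 1 \<le> c2 * s k" and c2: "c2 \<ge> 0"
  shows "Re (mtrace (\<rho> * Q)) \<le> (\<Sum>i\<in>{i. i < m \<and> \<not> P i}. r i) + 2 * c1 * c2 * \<epsilon> + 2 * \<epsilon>"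
proof -
  obtain T where T: "is_proj m T"
    and tr: "Re (mtrace (\<rho> * T)) - Re (mtrace (\<sigma> * T)) = trace_norm (\<rho> - \<sigma>) / 2"
    using helstrom_test[OF \<rho>(1,2) \<sigma>(1,2)] by blast
  note pQ = spectral_proj[OF Q]
  have U: "unitary_mat m U" "U \<in> carrier_mat m m" and V: "unitary_mat m V" "V \<in> carrier_mat m m"
    using \<rho>(1) \<sigma>(1) by (auto simp: spectral_def unitary_mat_def)
  have uc: "col U i \<in> carrier_vec m" "sq_norm (col U i) = 1" if "i < m" for i
    using U(2) unitary_col_norm[OF U(1) that] by (auto simp: sprod_self)
  let ?T' = "1\<^sub>m m - T"
  have e\<sigma>: "Re (mtrace (\<sigma> * T)) = (\<Sum>k<m. s k * sq_norm (T *\<^sub>v col V k))"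
    using mtrace_spectral_proj[OF \<sigma>(1) T] by simp
  have e\<rho>: "1 - Re (mtrace (\<rho> * T)) = (\<Sum>i<m. r i * sq_norm (?T' *\<^sub>v col U i))"
  proof -
    have "(\<Sum>i<m. r i * sq_norm (?T' *\<^sub>v col U i)) = (\<Sum>i<m. r i - r i * sq_norm (T *\<^sub>v col U i))"
    proof (rule sum.cong)
      fix i assume "i \<in> {..<m}"
      hence i: "i < m" by simp
      have "sq_norm (?T' *\<^sub>v col U i) = 1 - sq_norm (T *\<^sub>v col U i)"
        using proj_split[OF T uc(1)[OF i]] uc(2)[OF i] by linarith
      thus "r i * sq_norm (?T' *\<^sub>v col U i) = r i - r i * sq_norm (T *\<^sub>v col U i)"
        by (simp only: right_diff_distrib mult_1_right)
    qed simp
    thus ?thesis using mtrace_spectral_proj[OF \<rho>(1) T] \<rho>(2) by (simp add: sum_subtractf)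
  qed
  have "Re (mtrace (\<sigma> * T)) \<ge> 0" unfolding e\<sigma> using \<sigma>(3) by (intro sum_nonneg) auto
  moreover have "1 - Re (mtrace (\<rho> * T)) \<ge> 0" unfolding e\<rho> using \<rho>(3) by (intro sum_nonneg) auto
  \<comment> \<open>The two errors add up to at most \<open>\<epsilon>\<close>, so by nonnegativity
    each of them is.\<close>
  ultimately have err: "1 - Re (mtrace (\<rho> * T)) \<le> \<epsilon>" "Re (mtrace (\<sigma> * T)) \<le> \<epsilon>"
    using tr dist by linarith+
  have cs: "Q \<in> carrier_mat m m" "T \<in> carrier_mat m m" "T * T = T" "mat_adjoint T = T"
    using T pQ by (auto simp: is_proj_def)
  \<comment> \<open>Both sides are the trace of \<open>T * Q * T\<close>: the left one along the
    eigenbasis of \<open>\<rho>\<close>, the right one, after cyclic reduction to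
    \<open>Q * T\<close>, along the eigenbasis \<open>V\<close> that \<open>Q\<close> shares with
    \<open>\<sigma>\<close>.\<close>
  have hs: "(\<Sum>i<m. sq_norm (Q *\<^sub>v (T *\<^sub>v col U i))) = (\<Sum>k<m. q k * sq_norm (T *\<^sub>v col V k))"
  proof -
    have one: "spectral m (1\<^sub>m m) U (\<lambda>_. 1)"
      using U by (simp add: spectral_def unitary_right)
    have "((T * Q * T) *\<^sub>v col U i) \<bullet>c col U i = complex_of_real (sq_norm (Q *\<^sub>v (T *\<^sub>v col U i)))"
      if "i < m" for i
    proof -
      note u = uc(1)[OF that]
      have Tu: "T *\<^sub>v col U i \<in> carrier_vec m" using cs u by auto
      hence QTu: "Q *\<^sub>v (T *\<^sub>v col U i) \<in> carrier_vec m" using cs by auto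
      have "(T * Q * T) *\<^sub>v col U i = T *\<^sub>v (Q *\<^sub>v (T *\<^sub>v col U i))"
        using cs u Tu by (simp add: assoc_mult_mat_vec[of _ m m _ m])
      hence "((T * Q * T) *\<^sub>v col U i) \<bullet>c col U i = (Q *\<^sub>v (T *\<^sub>v col U i)) \<bullet>c (T *\<^sub>v col U i)"
        using adjoint_sprod[OF cs(2) QTu u] cs(4) by simp
      thus ?thesis using proj_form[OF pQ Tu] by simp
    qed
    hence "complex_of_real (\<Sum>i<m. sq_norm (Q *\<^sub>v (T *\<^sub>v col U i))) = mtrace (1\<^sub>m m * (T * Q * T))"
      using cs by (subst mtrace_spectral_mult[OF one]) auto
    also have "\<dots> = mtrace (T * Q * T)" using cs by simp
    also have "\<dots> = mtrace (T * (T * Q))" using cs by (intro mtrace_comm) auto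
    also have "T * (T * Q) = T * Q"
      using cs assoc_mult_mat[OF cs(2,2,1)] by simp
    also have "mtrace (T * Q) = mtrace (Q * T)" using cs by (intro mtrace_comm) auto
    also have "\<dots> = complex_of_real (\<Sum>k<m. q k * sq_norm (T *\<^sub>v col V k))"
      by (rule mtrace_spectral_proj[OF Q(1) T])
    finally show ?thesis by (simp only: of_real_eq_iff)
  qed
  \<comment> \<open>The operator inequality between \<open>Q\<close> and \<open>c2\<close> times
    \<open>\<sigma>\<close>, which can be checked on eigenvalues since both are diagonal in
    \<open>V\<close>.\<close>
  have "(\<Sum>k<m. q k * sq_norm (T *\<^sub>v col V k)) \<le> (\<Sum>k<m. c2 * (s k * sq_norm (T *\<^sub>v col V k)))"
  proof (rule sum_mono)
    fix k assume "k \<in> {..<m}"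
    hence "q k \<le> c2 * s k" using Q(2)[of k] qs[of k] \<sigma>(3)[of k] c2 by auto
    thus "q k * sq_norm (T *\<^sub>v col V k) \<le> c2 * (s k * sq_norm (T *\<^sub>v col V k))"
      unfolding mult.assoc[symmetric] by (intro mult_right_mono) auto
  qed
  also have "\<dots> = c2 * Re (mtrace (\<sigma> * T))" by (simp add: e\<sigma> sum_distrib_left)
  also have "\<dots> \<le> c2 * \<epsilon>" using err(2) c2 by (rule mult_left_mono)
  finally have hs_le: "(\<Sum>i<m. sq_norm (Q *\<^sub>v (T *\<^sub>v col U i))) \<le> c2 * \<epsilon>" unfolding hs .
  have "Re (mtrace (\<rho> * Q)) = (\<Sum>i<m. r i * sq_norm (Q *\<^sub>v col U i))"
    using mtrace_spectral_proj[OF \<rho>(1) pQ] by simp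
  \<comment> \<open>Where \<open>P i\<close> holds, pinching applies and \<open>r i\<close> is
    replaced by \<open>c1\<close> in the first term only; elsewhere the full weight
    \<open>r i\<close> is given away.\<close>
  also have "\<dots> \<le> (\<Sum>i<m. (if P i then 0 else r i) + 2 * c1 * sq_norm (Q *\<^sub>v (T *\<^sub>v col U i))
      + 2 * (r i * sq_norm (?T' *\<^sub>v col U i)))"
  proof (rule sum_mono)
    fix i assume "i \<in> {..<m}"
    hence i: "i < m" by simp
    note r0 = \<rho>(3)[OF i]
    show "r i * sq_norm (Q *\<^sub>v col U i) \<le> (if P i then 0 else r i)
      + 2 * c1 * sq_norm (Q *\<^sub>v (T *\<^sub>v col U i)) + 2 * (r i * sq_norm (?T' *\<^sub>v col U i))"
    proof (cases "P i")
      case True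
      have "r i * sq_norm (Q *\<^sub>v col U i)
          \<le> r i * (2 * sq_norm (Q *\<^sub>v (T *\<^sub>v col U i)) + 2 * sq_norm (?T' *\<^sub>v col U i))"
        using proj_pinching[OF pQ T uc(1)[OF i]] r0 by (rule mult_left_mono)
      moreover have "r i * sq_norm (Q *\<^sub>v (T *\<^sub>v col U i)) \<le> c1 * sq_norm (Q *\<^sub>v (T *\<^sub>v col U i))"
        using P[OF i True] by (intro mult_right_mono) auto
      ultimately show ?thesis using True by (simp add: algebra_simps)
    next
      case False
      have "sq_norm (Q *\<^sub>v col U i) \<le> 1" using proj_contraction[OF pQ uc(1)[OF i]] uc(2)[OF i] by simp
      hence "r i * sq_norm (Q *\<^sub>v col U i) \<le> r i" using r0 by (simp add: mult_left_le)
      thus ?thesis using False r0 c1 by (simp add: add_increasing2)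
    qed
  qed
  also have "\<dots> = (\<Sum>i\<in>{i. i < m \<and> \<not> P i}. r i) + 2 * c1 * (\<Sum>i<m. sq_norm (Q *\<^sub>v (T *\<^sub>v col U i)))
      + 2 * (1 - Re (mtrace (\<rho> * T)))"
  proof -
    have "(\<Sum>i<m. if P i then 0 else r i) = (\<Sum>i\<in>{i. i < m \<and> \<not> P i}. r i)"
      by (rule sum.mono_neutral_cong_right) auto
    thus ?thesis by (simp only: e\<rho> sum.distrib sum_distrib_left)
  qed
  also have "\<dots> \<le> (\<Sum>i\<in>{i. i < m \<and> \<not> P i}. r i) + 2 * c1 * (c2 * \<epsilon>) + 2 * \<epsilon>"
    using hs_le err(1) c1 by (intro add_mono mult_left_mono) auto
  finally show ?thesis by (simp add: mult.assoc)
qed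

section \<open>Selection of the code\<close>

lemma pigeonhole_fraction:
  fixes f :: "'a \<Rightarrow> nat"
  assumes A: "finite A" and f: "\<And>a. a \<in> A \<Longrightarrow> f a < M" and M: "M > 0"
  shows "\<exists>b. real (card {a \<in> A. f a = b}) \<ge> real (card A) / real M"
proof (rule ccontr)
  assume "\<not> ?thesis"
  hence *: "real (card {a \<in> A. f a = b}) < real (card A) / real M" for b by (simp add: not_le)
  \<comment> \<open>The fibres of \<open>f\<close> partition \<open>A\<close>; if all were smaller
    than average, their sizes could not add up to \<open>card A\<close>.\<close>
  have "card A = (\<Sum>b<M. card {a \<in> A. f a = b})"
    using A f sum.group[of A "{..<M}" f "\<lambda>_. 1 :: nat"] by (auto simp: image_subset_iff)
  hence "real (card A) = (\<Sum>b<M. real (card {a \<in> A. f a = b}))" by simp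
  also have "\<dots> < (\<Sum>b<M. real (card A) / real M)"
    using M * by (intro sum_strict_mono) auto
  also have "\<dots> = real (card A)" using M by simp
  finally show False by simp
qed

theorem theorem2:
  fixes W :: "'x \<Rightarrow> complex mat" and d n N :: nat and \<delta> :: real
    and u :: "nat \<Rightarrow> 'x list"
  assumes channel: "\<forall>x. density_op d (W x)"
    and n_pos: "n \<ge> 1"
    and delta_pos: "0 < \<delta>"
    and delta_le: "\<delta> \<le> sqrt (real n) * log 2 (real d)"
    and words: "\<forall>j\<in>{1..N}. length (u j) = n"
    and distinct: "\<forall>j\<in>{1..N}. \<forall>k\<in>{1..N}. j \<noteq> k \<longrightarrow>
        1 - trace_norm (tensor_word W (u j) - tensor_word W (u k)) / 2
          \<le> 2 powr (- 3 * \<delta> * sqrt (real n))"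
  shows "\<exists>C \<subseteq> {1..N}.
     real (card C) \<ge> real N / real_of_int \<lceil>real n * log 2 (real d)\<rceil> \<and>
     DI_code d W n C u (\<lambda>j. typ_proj W \<delta> (u j))
       (2 * 2 powr (- (\<delta>\<^sup>2 / (36 * K_const d))))
       (2 * 2 powr (- (\<delta>\<^sup>2 / (36 * K_const d))) + 6 * 2 powr (- \<delta> * sqrt (real n)))"
proof -
  define \<eta> where "\<eta> = 2 * 2 powr (- (\<delta>\<^sup>2 / (36 * K_const d)))"
  define a where "a = \<delta> * sqrt (real n)"
  \<comment> \<open>The two bounds on \<open>\<delta>\<close> force \<open>log 2 d > 0\<close>,
    which excludes trivial systems and makes the number of bins positive.\<close>
  have "0 < sqrt (real n) * log 2 (real d)" using delta_pos delta_le by linarith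
  hence logd: "log 2 (real d) > 0" using n_pos by (simp add: zero_less_mult_iff)
  have d: "d \<ge> 1" using logd by (cases "d = 0") (auto simp: log_def)
  from channel density_spectral have "\<forall>x. \<exists>U e. spectral d (W x) U e \<and> (\<forall>i<d. e i \<ge> 0) \<and> (\<Sum>i<d. e i) = 1"
    by blast
  then obtain U p where Wx: "\<And>x. spectral d (W x) (U x) (p x)"
    and p: "\<And>x i. i < d \<Longrightarrow> p x i \<ge> 0" "\<And>x. (\<Sum>i<d. p x i) = 1"
    by metis
  define \<rho> where "\<rho> = (\<lambda>j. tensor_word W (u j))"
  define w where "w = (\<lambda>j. word_weight d p (u j))"
  define S where "S = (\<lambda>j. \<Sum>k<d ^ n. entropy_term (w j k))"
  define typical where "typical = (\<lambda>j k. w j k > 0 \<and> S j - a \<le> - log 2 (w j k) \<and> - log 2 (w j k) \<le> S j + a)"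
  define E where "E = (\<lambda>j. typ_proj W \<delta> (u j))"
  have len: "length (u j) = n" if "j \<in> {1..N}" for j using words that by blast
  have "\<exists>V. spectral (d ^ n) (\<rho> j) V (w j)" if "j \<in> {1..N}" for j
    using tensor_word_spectral[where W = W and xs = "u j", OF Wx] by (simp add: \<rho>_def w_def len[OF that])
  then obtain V where V: "\<And>j. j \<in> {1..N} \<Longrightarrow> spectral (d ^ n) (\<rho> j) (V j) (w j)" by metis
  have w0: "w j k \<ge> 0" if "j \<in> {1..N}" "k < d ^ n" for j k
    using word_weight_nonneg[of d p k "u j"] p(1) that len by (simp add: w_def)
  have w1: "(\<Sum>k<d ^ n. w j k) = 1" if "j \<in> {1..N}" for j
    using sum_word_weight[where xs = "u j", OF p(2)] by (simp add: w_def len[OF that])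
  have S: "S j = vn_entropy (\<rho> j)" if "j \<in> {1..N}" for j
    using mtrace_spectral[OF spectral_mat_fun[OF V[OF that]]]
    by (simp add: vn_entropy_def S_def flip: of_real_sum)
  have Sb: "0 \<le> S j" "S j \<le> real n * log 2 d" if "j \<in> {1..N}" for j
    using word_entropy_bounds[where p = p and xs = "u j", OF p] sum_word_entropy[where p = p and xs = "u j", OF p]
    unfolding S_def w_def len[OF that] by linarith+
  \<comment> \<open>The typical projector is diagonal in the eigenbasis of its own state, with the
    indicator of typicality as eigenvalues.\<close>
  have sE: "spectral (d ^ n) (E j) (V j) (\<lambda>k. if typical j k then 1 else 0)" if "j \<in> {1..N}" for j
    unfolding E_def typ_proj_def Let_def typical_def a_def S[OF that] \<rho>_def len[OF that]
    by (rule spectral_mat_fun[OF V[OF that, unfolded \<rho>_def]])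
  have bad: "(\<Sum>k\<in>{k. k < d ^ n \<and> \<not> typical j k}. w j k) \<le> \<eta>" if "j \<in> {1..N}" for j
    using nontypical_weight[where p = p and xs = "u j", OF p len[OF that] n_pos d delta_pos delta_le]
    unfolding \<eta>_def typical_def a_def S_def w_def .
  have l1: "Re (mtrace (\<rho> j * E j)) \<ge> 1 - \<eta>" if j: "j \<in> {1..N}" for j
  proof -
    have "Re (mtrace (\<rho> j * E j)) = (\<Sum>k<d ^ n. w j k * (if typical j k then 1 else 0))"
      using mtrace_spectral[OF spectral_mult[OF V[OF j] sE[OF j]]] by simp
    also have "\<dots> = (\<Sum>k<d ^ n. w j k - (if typical j k then 0 else w j k))"
      by (intro sum.cong) auto
    also have "\<dots> = 1 - (\<Sum>k<d ^ n. if typical j k then 0 else w j k)"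
      by (simp add: sum_subtractf w1[OF j])
    also have "(\<Sum>k<d ^ n. if typical j k then 0 else w j k) = (\<Sum>k\<in>{k. k < d ^ n \<and> \<not> typical j k}. w j k)"
      by (rule sum.mono_neutral_cong_right) auto
    finally show ?thesis using bad[OF j] by simp
  qed
  have l2: "Re (mtrace (\<rho> j * E k)) \<le> \<eta> + 6 * 2 powr (- a)"
    if jk: "j \<in> {1..N}" "k \<in> {1..N}" "j \<noteq> k" and Sjk: "S k - S j \<le> 1" for j k
  proof -
    \<comment> \<open>Typical eigenvalues of \<open>\<rho> j\<close> are at most
      \<open>2 powr (a - S j)\<close>, those of \<open>\<rho> k\<close> at least
      \<open>2 powr (- (S k + a))\<close>; these supply the two constants of
      \<open>overlap_bound\<close>.\<close>
    have "Re (mtrace (\<rho> j * E k)) \<le> (\<Sum>i\<in>{i. i < d ^ n \<and> \<not> typical j i}. w j i)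
      + 2 * 2 powr (a - S j) * 2 powr (S k + a) * 2 powr (- 3 * a) + 2 * 2 powr (- 3 * a)"
    proof (rule overlap_bound[OF V[OF jk(1)] w1[OF jk(1)] w0[OF jk(1)] V[OF jk(2)] w1[OF jk(2)] w0[OF jk(2)] sE[OF jk(2)]])
      show "1 - trace_norm (\<rho> j - \<rho> k) / 2 \<le> 2 powr (- 3 * a)"
        using distinct jk by (simp add: \<rho>_def a_def mult.assoc)
      show "w j i \<le> 2 powr (a - S j)" if "typical j i" for i
      proof -
        have "w j i > 0" "log 2 (w j i) \<le> a - S j" using that by (auto simp: typical_def)
        thus ?thesis by (simp add: log_le_iff)
      qed
      show "1 \<le> 2 powr (S k + a) * w k i" if "(if typical k i then 1 else 0) = (1 :: real)" for i
      proof -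
        have "w k i > 0" "- (S k + a) \<le> log 2 (w k i)" using that by (auto simp: typical_def split: if_splits)
        hence "2 powr (- (S k + a)) \<le> w k i" by (simp add: le_log_iff)
        hence "2 powr (S k + a) * 2 powr (- (S k + a)) \<le> 2 powr (S k + a) * w k i"
          by (intro mult_left_mono) auto
        thus ?thesis by (simp add: powr_add[symmetric])
      qed
    qed auto
    \<comment> \<open>The exponents add up to \<open>S k - S j - a\<close>. The entropy gap of at
      most \<open>1\<close> doubles the first term to \<open>4 * 2 powr (- a)\<close>, and the
      second adds \<open>2 * 2 powr (- a)\<close>, whence the constant \<open>6\<close>.\<close>
    also have "2 * 2 powr (a - S j) * 2 powr (S k + a) * 2 powr (- 3 * a) = 2 * 2 powr (S k - S j - a)"
      by (simp add: powr_add[symmetric] mult.assoc)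
    also have "2 powr (S k - S j - a) \<le> 2 powr (1 - a)"
      using Sjk by (intro powr_mono) auto
    also have "(2 :: real) powr (1 - a) = 2 * 2 powr (- a)"
      using powr_add[of 2 1 "- a"] by simp
    also have "(2 :: real) powr (- 3 * a) \<le> 2 powr (- a)"
      using delta_pos by (intro powr_mono) (auto simp: a_def)
    finally show ?thesis using bad[OF jk(1)] by simp
  qed
  define M where "M = nat \<lceil>real n * log 2 (real d)\<rceil>"
  have nd: "real n * log 2 (real d) > 0" using n_pos logd by simp
  hence M: "M > 0" "real M = real_of_int \<lceil>real n * log 2 (real d)\<rceil>" "real n * log 2 (real d) \<le> real M"
    by (auto simp: M_def)
  \<comment> \<open>Unit intervals of entropy. The cap at \<open>M - 1\<close> puts the extreme
    value \<open>S j = M\<close>, possible if \<open>n * log 2 d\<close> is an integer, into the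
    last bin, which is therefore closed.\<close>
  define bin where "bin = (\<lambda>j. min (nat \<lfloor>S j\<rfloor>) (M - 1))"
  have bin: "real (bin j) \<le> S j \<and> S j \<le> real (bin j) + 1" if "j \<in> {1..N}" for j
    using Sb[OF that] M unfolding bin_def by (auto simp: min_def of_nat_diff) linarith+
  have "bin j < M" for j using M(1) by (simp add: bin_def min_def) linarith
  then obtain b where b: "real (card {j \<in> {1..N}. bin j = b}) \<ge> real (card {1..N}) / real M"
    using pigeonhole_fraction[of "{1..N}" bin M] M(1) by blast
  define C where "C = {j \<in> {1..N}. bin j = b}"
  have "S k - S j \<le> 1" if "j \<in> C" "k \<in> C" for j k
    using bin[of j] bin[of k] that by (auto simp: C_def)
  hence "DI_code d W n C u E \<eta> (\<eta> + 6 * 2 powr (- a))"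
    using len l1 l2 spectral_effect[OF sE] by (auto simp: DI_code_def C_def \<rho>_def)
  moreover have "C \<subseteq> {1..N}" by (auto simp: C_def)
  ultimately show ?thesis
    using b M(2) unfolding E_def \<eta>_def a_def C_def[symmetric] by (intro exI[of _ C]) simp
qed

end
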